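(* Let $A\,|\,B\,|\,C$ be a tower of rings such that the right module $A_B$ is finitely generated projective. Then the tower is left depth three if and only if, for some positive integer $N$, the natural $A$-$C$-bimodule $\operatorname{End}A_B$ is isomorphic to a direct summand of the $A$-$C$-bimodule $A^N$.
   Context: Rings are unital. A tower $A\,|\,B\,|\,C$ is a pair of unital ring homomorphisms $C\to B\to A$, with induced bimodule structures. The tower is left depth three ($\ell$D3) if, as $C$-$A$-bimodules, $A\otimes_BA$ is isomorphic to a direct summand of $A^N$ for some positive integer $N$. $\operatorname{End}A_B$ is the ring of right $B$-linear endomorphisms of $A$; its natural $A$-$C$-bimodule structure is $(a\cdot f\cdot c)(x)=a f(cx)$ for $a,x\in A$, $c\in C$, $f\in\operatorname{End}A_B$. *)

theory Defs
  imports "HOL-Algebra.Algebra"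
begin

section \<open>Modules and bimodules over arbitrary unital rings\<close>

text \<open>
  The module theory of HOL-Algebra is restricted to commutative scalars. As in its
  \<^type>\<open>module\<close> record, the multiplicative fields \<open>mult\<close> and \<open>one\<close> inherited from the
  ring record play no role for a module. A right \<open>S\<close>-module is given by \<open>rsmult\<close>; an
  \<open>R\<close>-\<open>S\<close>-bimodule has a left action \<open>lsmult\<close> of \<open>R\<close> in addition.
\<close>

record ('s, 'm) right_module = "'m ring" +
  rsmult :: "'m \<Rightarrow> 's \<Rightarrow> 'm"

record ('s, 'm, 'r) bimodule = "('s, 'm) right_module" +
  lsmult :: "'r \<Rightarrow> 'm \<Rightarrow> 'm"

locale right_module = R?: ring R + M?: abelian_group M
  for R :: "('s, 'k) ring_scheme" (structure)
    and M :: "('s, 'm, 'e) right_module_scheme" (structure) +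
  assumes rsmult_closed:
      "\<lbrakk>x \<in> carrier M; r \<in> carrier R\<rbrakk> \<Longrightarrow> rsmult M x r \<in> carrier M"
    and rsmult_add_left:
      "\<lbrakk>x \<in> carrier M; y \<in> carrier M; r \<in> carrier R\<rbrakk> \<Longrightarrow>
        rsmult M (x \<oplus>\<^bsub>M\<^esub> y) r = rsmult M x r \<oplus>\<^bsub>M\<^esub> rsmult M y r"
    and rsmult_add_right:
      "\<lbrakk>x \<in> carrier M; r \<in> carrier R; s \<in> carrier R\<rbrakk> \<Longrightarrow>
        rsmult M x (r \<oplus>\<^bsub>R\<^esub> s) = rsmult M x r \<oplus>\<^bsub>M\<^esub> rsmult M x s"
    and rsmult_assoc:
      "\<lbrakk>x \<in> carrier M; r \<in> carrier R; s \<in> carrier R\<rbrakk> \<Longrightarrow>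
        rsmult M x (r \<otimes>\<^bsub>R\<^esub> s) = rsmult M (rsmult M x r) s"
    and rsmult_one:
      "x \<in> carrier M \<Longrightarrow> rsmult M x \<one>\<^bsub>R\<^esub> = x"

definition right_module_hom ::
  "('s, 'k) ring_scheme \<Rightarrow> ('s, 'm, 'e) right_module_scheme \<Rightarrow>
    ('s, 'n, 'f) right_module_scheme \<Rightarrow> ('m \<Rightarrow> 'n) set" where
  "right_module_hom R M N =
    {f \<in> carrier M \<rightarrow> carrier N.
      (\<forall>x\<in>carrier M. \<forall>y\<in>carrier M. f (x \<oplus>\<^bsub>M\<^esub> y) = f x \<oplus>\<^bsub>N\<^esub> f y) \<and>
      (\<forall>x\<in>carrier M. \<forall>r\<in>carrier R. f (rsmult M x r) = rsmult N (f x) r)}"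

definition finitely_generated_right_module ::
  "('s, 'k) ring_scheme \<Rightarrow> ('s, 'm, 'e) right_module_scheme \<Rightarrow> bool" where
  "finitely_generated_right_module R M \<longleftrightarrow>
    right_module R M \<and>
    (\<exists>S. finite S \<and> S \<subseteq> carrier M \<and>
      (\<forall>x\<in>carrier M. \<exists>r\<in>S \<rightarrow> carrier R. x = (\<Oplus>\<^bsub>M\<^esub>s\<in>S. rsmult M s (r s))))"

text \<open>
  Projectivity is the lifting property along surjections \<open>p: V \<rightarrow> W\<close>. HOL cannot quantify over
  the carrier types of \<open>V\<close> and \<open>W\<close>, so types large enough to make the property equivalent to the
  one over all modules are fixed: \<open>W\<close> may be \<open>M\<close> itself, and \<open>V\<close> the free module of finitely
  supported functions from \<open>carrier M\<close> to \<open>carrier R\<close>. Splitting the canonical surjection from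
  the latter to \<open>M\<close> exhibits \<open>M\<close> as a direct summand of a free module.
\<close>

definition projective_right_module ::
  "('s, 'k) ring_scheme \<Rightarrow> ('s, 'm, 'e) right_module_scheme \<Rightarrow> bool" where
  "projective_right_module R M \<longleftrightarrow>
    right_module R M \<and>
    (\<forall>(V :: ('s, 'm \<Rightarrow> 's) right_module) (W :: ('s, 'm) right_module) p f.
      right_module R V \<and> right_module R W \<and>
      p \<in> right_module_hom R V W \<and> p ` carrier V = carrier W \<and>
      f \<in> right_module_hom R M W \<longrightarrow>
      (\<exists>q\<in>right_module_hom R M V. \<forall>x\<in>carrier M. p (q x) = f x))"

definition bimodule_iso ::
  "('r, 'k) ring_scheme \<Rightarrow> ('s, 'l) ring_scheme \<Rightarrow> ('s, 'm, 'r, 'e) bimodule_scheme \<Rightarrow>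
    ('s, 'n, 'r, 'f) bimodule_scheme \<Rightarrow> ('m \<Rightarrow> 'n) set" where
  "bimodule_iso R S M N =
    {f. bij_betw f (carrier M) (carrier N) \<and>
      (\<forall>x\<in>carrier M. \<forall>y\<in>carrier M. f (x \<oplus>\<^bsub>M\<^esub> y) = f x \<oplus>\<^bsub>N\<^esub> f y) \<and>
      (\<forall>r\<in>carrier R. \<forall>x\<in>carrier M. f (lsmult M r x) = lsmult N r (f x)) \<and>
      (\<forall>x\<in>carrier M. \<forall>s\<in>carrier S. f (rsmult M x s) = rsmult N (f x) s)}"

definition subbimodule ::
  "('r, 'k) ring_scheme \<Rightarrow> ('s, 'l) ring_scheme \<Rightarrow> 'm set \<Rightarrow>
    ('s, 'm, 'r, 'e) bimodule_scheme \<Rightarrow> bool" where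
  "subbimodule R S P M \<longleftrightarrow>
    additive_subgroup P M \<and>
    (\<forall>r\<in>carrier R. \<forall>x\<in>P. lsmult M r x \<in> P) \<and>
    (\<forall>x\<in>P. \<forall>s\<in>carrier S. rsmult M x s \<in> P)"

definition direct_summand ::
  "('r, 'k) ring_scheme \<Rightarrow> ('s, 'l) ring_scheme \<Rightarrow> 'm set \<Rightarrow>
    ('s, 'm, 'r, 'e) bimodule_scheme \<Rightarrow> bool" where
  "direct_summand R S P M \<longleftrightarrow>
    subbimodule R S P M \<and>
    (\<exists>Q. subbimodule R S Q M \<and> P \<inter> Q = {\<zero>\<^bsub>M\<^esub>} \<and> P <+>\<^bsub>M\<^esub> Q = carrier M)"

definition iso_to_direct_summand ::
  "('r, 'k) ring_scheme \<Rightarrow> ('s, 'l) ring_scheme \<Rightarrow> ('s, 'n, 'r, 'f) bimodule_scheme \<Rightarrow>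
    ('s, 'm, 'r, 'e) bimodule_scheme \<Rightarrow> bool" where
  "iso_to_direct_summand R S N M \<longleftrightarrow>
    (\<exists>P. direct_summand R S P M \<and> bimodule_iso R S N (M\<lparr>carrier := P\<rparr>) \<noteq> {})"

definition power_bimodule ::
  "nat \<Rightarrow> ('s, 'm, 'r, 'e) bimodule_scheme \<Rightarrow> ('s, nat \<Rightarrow> 'm, 'r) bimodule" where
  "power_bimodule n M =
    \<lparr>carrier = {..<n} \<rightarrow>\<^sub>E carrier M,
     monoid.mult = (\<lambda>u v. \<lambda>i\<in>{..<n}. u i \<otimes>\<^bsub>M\<^esub> v i),
     monoid.one = (\<lambda>i\<in>{..<n}. \<one>\<^bsub>M\<^esub>),
     ring.zero = (\<lambda>i\<in>{..<n}. \<zero>\<^bsub>M\<^esub>),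
     ring.add = (\<lambda>u v. \<lambda>i\<in>{..<n}. u i \<oplus>\<^bsub>M\<^esub> v i),
     rsmult = (\<lambda>u s. \<lambda>i\<in>{..<n}. rsmult M (u i) s),
     lsmult = (\<lambda>r u. \<lambda>i\<in>{..<n}. lsmult M r (u i))\<rparr>"


section \<open>Tensor products over a noncommutative ring\<close>

text \<open>
  For a right \<open>B\<close>-module \<open>M\<close> and a left \<open>B\<close>-module \<open>N\<close>, the group \<open>M \<otimes>\<^sub>B N\<close> is the free
  abelian group on \<open>carrier M \<times> carrier N\<close> modulo the subgroup generated by the elements
  expressing biadditivity and \<open>B\<close>-balancedness.
\<close>

definition tensor_relations ::
  "('b, 'k) ring_scheme \<Rightarrow> ('b, 'm, 'r, 'e) bimodule_scheme \<Rightarrow>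
    ('s, 'n, 'b, 'f) bimodule_scheme \<Rightarrow> ('m \<times> 'n \<Rightarrow>\<^sub>0 int) set" where
  "tensor_relations B M N =
    {frag_of (x \<oplus>\<^bsub>M\<^esub> x', y) - frag_of (x, y) - frag_of (x', y) | x x' y.
        x \<in> carrier M \<and> x' \<in> carrier M \<and> y \<in> carrier N} \<union>
    {frag_of (x, y \<oplus>\<^bsub>N\<^esub> y') - frag_of (x, y) - frag_of (x, y') | x y y'.
        x \<in> carrier M \<and> y \<in> carrier N \<and> y' \<in> carrier N} \<union>
    {frag_of (rsmult M x b, y) - frag_of (x, lsmult N b y) | x b y.
        x \<in> carrier M \<and> b \<in> carrier B \<and> y \<in> carrier N}"

definition tensor_kernel ::
  "('b, 'k) ring_scheme \<Rightarrow> ('b, 'm, 'r, 'e) bimodule_scheme \<Rightarrow>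
    ('s, 'n, 'b, 'f) bimodule_scheme \<Rightarrow> ('m \<times> 'n \<Rightarrow>\<^sub>0 int) set" where
  "tensor_kernel B M N =
    generate (free_Abelian_group (carrier M \<times> carrier N)) (tensor_relations B M N)"

text \<open>
  An endomorphism of the free abelian group that preserves the kernel \<open>K\<close> acts on a coset \<open>T\<close>
  by sending it to the coset \<open>K + \<phi>(T)\<close>. The actions on the tensor product are those with
  \<open>r (x \<otimes> y) s = (r x) \<otimes> (y s)\<close>. The fields \<open>mult\<close> and \<open>one\<close> are irrelevant.
\<close>

definition tensor_bimodule ::
  "('b, 'k) ring_scheme \<Rightarrow> ('b, 'm, 'r, 'e) bimodule_scheme \<Rightarrow>
    ('s, 'n, 'b, 'f) bimodule_scheme \<Rightarrow> ('s, ('m \<times> 'n \<Rightarrow>\<^sub>0 int) set, 'r) bimodule" where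
  "tensor_bimodule B M N =
    (let F = free_Abelian_group (carrier M \<times> carrier N);
         K = tensor_kernel B M N
     in \<lparr>carrier = carrier (F Mod K),
         monoid.mult = undefined,
         monoid.one = undefined,
         ring.zero = \<one>\<^bsub>F Mod K\<^esub>,
         ring.add = (\<lambda>T U. T \<otimes>\<^bsub>F Mod K\<^esub> U),
         rsmult = (\<lambda>T s. K <#>\<^bsub>F\<^esub> frag_extend (\<lambda>(x, y). frag_of (x, rsmult N y s)) ` T),
         lsmult = (\<lambda>r T. K <#>\<^bsub>F\<^esub> frag_extend (\<lambda>(x, y). frag_of (lsmult M r x, y)) ` T)\<rparr>)"


section \<open>Towers of rings\<close>

text \<open>A tower \<open>A | B | C\<close> with structure maps \<open>h: C \<rightarrow> B\<close> and \<open>g: B \<rightarrow> A\<close>.\<close>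

locale ring_tower = A: ring A + B: ring B + C: ring C
  for A :: "('a, 'k) ring_scheme" and B :: "('b, 'l) ring_scheme"
    and C :: "('c, 'm) ring_scheme" and g :: "'b \<Rightarrow> 'a" and h :: "'c \<Rightarrow> 'b" +
  assumes hom_B_A: "g \<in> ring_hom B A"
    and hom_C_B: "h \<in> ring_hom C B"

text \<open>\<open>A\<close> as the bimodule with scalars acting through \<open>\<phi>\<close> on the left and \<open>\<psi>\<close> on the right.\<close>

definition ring_bimodule ::
  "('r \<Rightarrow> 'a) \<Rightarrow> ('s \<Rightarrow> 'a) \<Rightarrow> ('a, 'k) ring_scheme \<Rightarrow> ('s, 'a, 'r) bimodule" where
  "ring_bimodule \<phi> \<psi> A =
    \<lparr>carrier = carrier A, monoid.mult = (\<otimes>\<^bsub>A\<^esub>), monoid.one = \<one>\<^bsub>A\<^esub>,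
     ring.zero = \<zero>\<^bsub>A\<^esub>, ring.add = (\<oplus>\<^bsub>A\<^esub>),
     rsmult = (\<lambda>x s. x \<otimes>\<^bsub>A\<^esub> \<psi> s),
     lsmult = (\<lambda>r x. \<phi> r \<otimes>\<^bsub>A\<^esub> x)\<rparr>"

definition left_depth_three ::
  "('a, 'k) ring_scheme \<Rightarrow> ('b, 'l) ring_scheme \<Rightarrow> ('c, 'm) ring_scheme \<Rightarrow>
    ('b \<Rightarrow> 'a) \<Rightarrow> ('c \<Rightarrow> 'b) \<Rightarrow> bool" where
  "left_depth_three A B C g h \<longleftrightarrow>
    (\<exists>N>0. iso_to_direct_summand C A
      (tensor_bimodule B (ring_bimodule (g \<circ> h) g A) (ring_bimodule g id A))
      (power_bimodule N (ring_bimodule (g \<circ> h) id A)))"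

text \<open>
  The ring of endomorphisms of \<open>A\<close> as a right \<open>B\<close>-module, with the \<open>A\<close>-\<open>C\<close>-bimodule structure
  \<open>(a f c)(x) = a f(c x)\<close>. Functions are normalised to be \<^const>\<open>undefined\<close> outside
  \<open>carrier A\<close>, so that equality of endomorphisms is equality of functions.
\<close>

definition End_bimodule ::
  "('a, 'k) ring_scheme \<Rightarrow> ('b, 'l) ring_scheme \<Rightarrow> ('b \<Rightarrow> 'a) \<Rightarrow> ('c \<Rightarrow> 'b) \<Rightarrow>
    ('c, 'a \<Rightarrow> 'a, 'a) bimodule" where
  "End_bimodule A B g h =
    \<lparr>carrier = right_module_hom B (ring_bimodule id g A) (ring_bimodule id g A)
       \<inter> extensional (carrier A),
     monoid.mult = compose (carrier A),
     monoid.one = (\<lambda>x\<in>carrier A. x),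
     ring.zero = (\<lambda>x\<in>carrier A. \<zero>\<^bsub>A\<^esub>),
     ring.add = (\<lambda>f f'. \<lambda>x\<in>carrier A. f x \<oplus>\<^bsub>A\<^esub> f' x),
     rsmult = (\<lambda>f c. \<lambda>x\<in>carrier A. f (g (h c) \<otimes>\<^bsub>A\<^esub> x)),
     lsmult = (\<lambda>a f. \<lambda>x\<in>carrier A. a \<otimes>\<^bsub>A\<^esub> f x)\<rparr>"

end

theory Submission
  imports Defs
begin

text \<open>
  Write \<open>E = End A\<^sub>B\<close>. A summand of a power \<open>M\<^sup>N\<close> is the same as a factorization of the identity
  through \<open>N\<close> copies of \<open>M\<close> (\<open>iso_to_direct_summand_power_iff\<close>), so both conditions can be
  written as identities between finitely many elements and maps.

  A \<open>C\<close>-\<open>A\<close>-homomorphism \<open>A \<rightarrow> A \<otimes>\<^sub>B A\<close> is \<open>a \<mapsto> t a\<close> for a tensor \<open>t\<close> commuting with \<open>C\<close>, and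
  a \<open>C\<close>-\<open>A\<close>-homomorphism \<open>A \<otimes>\<^sub>B A \<rightarrow> A\<close> is \<open>x \<otimes> y \<mapsto> \<beta>(x) y\<close> for some \<open>\<beta> \<in> E\<close> commuting with \<open>C\<close>.
  Hence the tower is left depth three iff there are such \<open>t\<^sub>i\<close> and \<open>\<beta>\<^sub>i\<close> with
  \<open>x \<otimes> 1 = \<Sum> t\<^sub>i \<beta>\<^sub>i(x)\<close> for all \<open>x\<close> (\<open>left_depth_three_iff\<close>). In the same way \<open>E\<close> is
  isomorphic to a summand of \<open>A\<^sup>N\<close> iff there are \<open>\<beta>\<^sub>i \<in> E\<close> commuting with \<open>C\<close> and
  \<open>A\<close>-\<open>C\<close>-homomorphisms \<open>\<tau>\<^sub>i: E \<rightarrow> A\<close> with \<open>f = \<Sum> \<tau>\<^sub>i(f) \<beta>\<^sub>i\<close> for all \<open>f\<close>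
  (\<open>End_direct_summand_iff\<close>).

  The two systems share the \<open>\<beta>\<^sub>i\<close>, and it remains to exchange the \<open>t\<^sub>i\<close> for the \<open>\<tau>\<^sub>i\<close>. Every
  \<open>f \<in> E\<close> extends to the right \<open>A\<close>-linear map \<open>ev f: x \<otimes> y \<mapsto> f(x) y\<close>, and
  \<open>\<tau>\<^sub>i(f) = ev f (t\<^sub>i)\<close> turns the first identity into the second: apply \<open>ev f\<close> to it.
  Conversely, let \<open>k\<close> and \<open>\<phi>\<^sub>k\<close> run through a finite dual basis of \<open>A\<^sub>B\<close> (\<open>dual_basis\<close>), and
  regard \<open>\<phi>\<^sub>k\<close> as an element \<open>\<gamma>\<^sub>k = g \<phi>\<^sub>k\<close> of \<open>E\<close>. Then \<open>t\<^sub>i = \<Sum> k \<otimes> \<tau>\<^sub>i(\<gamma>\<^sub>k)\<close> recovers \<open>\<tau>\<^sub>i\<close>, because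
  \<open>f = \<Sum> f(k) \<gamma>\<^sub>k\<close>, and the second identity applied to the \<open>\<gamma>\<^sub>k\<close> gives the first.
\<close>

section \<open>Bimodules and their homomorphisms\<close>

locale bimodule = L?: ring R + right_module S M
  for R :: "('r, 'k) ring_scheme" (structure) and S :: "('s, 'l) ring_scheme" (structure)
    and M :: "('s, 'm, 'r, 'e) bimodule_scheme" (structure) +
  assumes lsmult_closed:
      "\<lbrakk>r \<in> carrier R; x \<in> carrier M\<rbrakk> \<Longrightarrow> lsmult M r x \<in> carrier M"
    and lsmult_add_right:
      "\<lbrakk>r \<in> carrier R; x \<in> carrier M; y \<in> carrier M\<rbrakk> \<Longrightarrow>
        lsmult M r (x \<oplus>\<^bsub>M\<^esub> y) = lsmult M r x \<oplus>\<^bsub>M\<^esub> lsmult M r y"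
    and lsmult_add_left:
      "\<lbrakk>r \<in> carrier R; r' \<in> carrier R; x \<in> carrier M\<rbrakk> \<Longrightarrow>
        lsmult M (r \<oplus>\<^bsub>R\<^esub> r') x = lsmult M r x \<oplus>\<^bsub>M\<^esub> lsmult M r' x"
    and lsmult_assoc:
      "\<lbrakk>r \<in> carrier R; r' \<in> carrier R; x \<in> carrier M\<rbrakk> \<Longrightarrow>
        lsmult M (r \<otimes>\<^bsub>R\<^esub> r') x = lsmult M r (lsmult M r' x)"
    and lsmult_one:
      "x \<in> carrier M \<Longrightarrow> lsmult M \<one>\<^bsub>R\<^esub> x = x"
    and lsmult_rsmult:
      "\<lbrakk>r \<in> carrier R; x \<in> carrier M; s \<in> carrier S\<rbrakk> \<Longrightarrow>
        rsmult M (lsmult M r x) s = lsmult M r (rsmult M x s)"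

definition bimodule_hom ::
  "('r, 'k) ring_scheme \<Rightarrow> ('s, 'l) ring_scheme \<Rightarrow> ('s, 'm, 'r, 'e) bimodule_scheme \<Rightarrow>
    ('s, 'n, 'r, 'f) bimodule_scheme \<Rightarrow> ('m \<Rightarrow> 'n) set" where
  "bimodule_hom R S M N =
    {f. abelian_group_hom M N f \<and>
      (\<forall>r\<in>carrier R. \<forall>x\<in>carrier M. f (lsmult M r x) = lsmult N r (f x)) \<and>
      (\<forall>x\<in>carrier M. \<forall>s\<in>carrier S. f (rsmult M x s) = rsmult N (f x) s)}"

lemma abelian_group_hom_of_additive:
  assumes "abelian_group M" and "abelian_group N"
    and "\<And>x. x \<in> carrier M \<Longrightarrow> f x \<in> carrier N"
    and "\<And>x y. \<lbrakk>x \<in> carrier M; y \<in> carrier M\<rbrakk> \<Longrightarrow> f (x \<oplus>\<^bsub>M\<^esub> y) = f x \<oplus>\<^bsub>N\<^esub> f y"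
  shows "abelian_group_hom M N f"
proof -
  interpret M: abelian_group M by fact
  interpret N: abelian_group N by fact
  show ?thesis
    by (intro abelian_group_homI assms(1,2) group_hom.intro M.add.is_group N.add.is_group
        group_hom_axioms.intro) (auto simp: hom_def assms)
qed

lemma bimodule_homI:
  assumes "abelian_group M" and "abelian_group N"
    and "\<And>x. x \<in> carrier M \<Longrightarrow> f x \<in> carrier N"
    and "\<And>x y. \<lbrakk>x \<in> carrier M; y \<in> carrier M\<rbrakk> \<Longrightarrow> f (x \<oplus>\<^bsub>M\<^esub> y) = f x \<oplus>\<^bsub>N\<^esub> f y"
    and "\<And>r x. \<lbrakk>r \<in> carrier R; x \<in> carrier M\<rbrakk> \<Longrightarrow> f (lsmult M r x) = lsmult N r (f x)"
    and "\<And>x s. \<lbrakk>x \<in> carrier M; s \<in> carrier S\<rbrakk> \<Longrightarrow> f (rsmult M x s) = rsmult N (f x) s"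
  shows "f \<in> bimodule_hom R S M N"
  using abelian_group_hom_of_additive[of M N f] assms by (simp add: bimodule_hom_def)

lemma bimodule_homD:
  assumes "f \<in> bimodule_hom R S M N"
  shows "abelian_group_hom M N f"
    and "x \<in> carrier M \<Longrightarrow> f x \<in> carrier N"
    and "\<lbrakk>x \<in> carrier M; y \<in> carrier M\<rbrakk> \<Longrightarrow> f (x \<oplus>\<^bsub>M\<^esub> y) = f x \<oplus>\<^bsub>N\<^esub> f y"
    and "\<lbrakk>r \<in> carrier R; x \<in> carrier M\<rbrakk> \<Longrightarrow> f (lsmult M r x) = lsmult N r (f x)"
    and "\<lbrakk>x \<in> carrier M; s \<in> carrier S\<rbrakk> \<Longrightarrow> f (rsmult M x s) = rsmult N (f x) s"
  using assms abelian_group_hom.hom_closed[of M N f] abelian_group_hom.hom_add[of M N f]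
  by (auto simp: bimodule_hom_def)

lemma (in abelian_group_hom) hom_finsum:
  "u \<in> I \<rightarrow> carrier G \<Longrightarrow> h (finsum G u I) = (\<Oplus>\<^bsub>H\<^esub>i\<in>I. h (u i))"
  by (induction I rule: infinite_finite_induct) (auto simp: Pi_def)

lemma (in abelian_group) minus_eq_minus_of_add_eq:
  assumes "a \<in> carrier G" "b \<in> carrier G" "c \<in> carrier G" "d \<in> carrier G"
    and "a \<oplus> b = c \<oplus> d"
  shows "a \<ominus> c = d \<ominus> b"
proof -
  have "a \<ominus> c = (a \<oplus> b) \<oplus> (\<ominus> b \<oplus> \<ominus> c)"
    using assms(1-4) by (simp add: a_minus_def a_assoc r_neg2)
  also have "\<dots> = (c \<oplus> \<ominus> c) \<oplus> (d \<oplus> \<ominus> b)"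
    unfolding assms(5) using assms(1-4) by (simp only: a_ac a_inv_closed a_closed)
  finally show ?thesis
    using assms(1-4) by (simp add: a_minus_def r_neg)
qed

lemma (in bimodule) lsmult_hom:
  "r \<in> carrier R \<Longrightarrow> abelian_group_hom M M (lsmult M r)"
  by (intro abelian_group_hom_of_additive abelian_group_axioms lsmult_closed lsmult_add_right)

lemma (in right_module) rsmult_hom:
  "r \<in> carrier R \<Longrightarrow> abelian_group_hom M M (\<lambda>x. rsmult M x r)"
  by (intro abelian_group_hom_of_additive abelian_group_axioms rsmult_closed rsmult_add_left)


section \<open>Direct summands as retracts\<close>

lemma (in bimodule) kernel_subbimodule:
  assumes "bimodule R S V" and "\<pi> \<in> bimodule_hom R S M V"
  shows "subbimodule R S {u \<in> carrier M. \<pi> u = \<zero>\<^bsub>V\<^esub>} M"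
proof -
  interpret V: bimodule R S V by fact
  interpret \<pi>: abelian_group_hom M V \<pi> using assms(2) by (rule bimodule_homD)
  have "additive_subgroup {u \<in> carrier M. \<pi> u = \<zero>\<^bsub>V\<^esub>} M"
    using \<pi>.additive_subgroup_a_kernel unfolding a_kernel_def' .
  moreover have "\<pi> (lsmult M r u) = \<zero>\<^bsub>V\<^esub>"
    if "r \<in> carrier R" "u \<in> carrier M" "\<pi> u = \<zero>\<^bsub>V\<^esub>" for r u
    using that bimodule_homD(4)[OF assms(2)] abelian_group_hom.hom_zero[OF V.lsmult_hom] by metis
  moreover have "\<pi> (rsmult M u s) = \<zero>\<^bsub>V\<^esub>"
    if "s \<in> carrier S" "u \<in> carrier M" "\<pi> u = \<zero>\<^bsub>V\<^esub>" for s u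
    using that bimodule_homD(5)[OF assms(2)] abelian_group_hom.hom_zero[OF V.rsmult_hom] by metis
  ultimately show ?thesis
    by (simp add: subbimodule_def lsmult_closed rsmult_closed)
qed

lemma (in bimodule) image_subbimodule:
  assumes "bimodule R S V" and "\<iota> \<in> bimodule_hom R S V M"
  shows "subbimodule R S (\<iota> ` carrier V) M"
proof -
  interpret V: bimodule R S V by fact
  interpret \<iota>: abelian_group_hom V M \<iota> using assms(2) by (rule bimodule_homD)
  interpret \<iota>: group_hom "add_monoid V" "add_monoid M" \<iota> by (rule \<iota>.a_group_hom)
  have "subgroup (\<iota> ` carrier V) (add_monoid M)"
    using \<iota>.img_is_subgroup by simp
  then show ?thesis
    using bimodule_homD(4,5)[OF assms(2), symmetric]
    by (auto simp: subbimodule_def additive_subgroup_def V.lsmult_closed V.rsmult_closed)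
qed

text \<open>
  A complement \<open>Q\<close> of the image of an embedding \<open>f\<close> makes the decomposition \<open>u = f x \<oplus> q\<close> of
  every \<open>u\<close> unique, and \<open>u \<mapsto> x\<close> is then the retraction. Conversely the kernel of a retraction
  is a complement of the image of its section.
\<close>

lemma (in bimodule) iso_to_direct_summand_iff_retract:
  assumes "bimodule R S V"
  shows "iso_to_direct_summand R S V M \<longleftrightarrow>
    (\<exists>\<iota>\<in>bimodule_hom R S V M. \<exists>\<pi>\<in>bimodule_hom R S M V. \<forall>x\<in>carrier V. \<pi> (\<iota> x) = x)"
    (is "?lhs \<longleftrightarrow> ?rhs")
proof
  interpret V: bimodule R S V by fact
  assume ?lhs
  then obtain P Q f where P: "subbimodule R S P M" and Q: "subbimodule R S Q M"
    and PQ: "P \<inter> Q = {\<zero>\<^bsub>M\<^esub>}" "P <+>\<^bsub>M\<^esub> Q = carrier M"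
    and f: "f \<in> bimodule_iso R S V (M\<lparr>carrier := P\<rparr>)"
    unfolding iso_to_direct_summand_def direct_summand_def by blast
  interpret P: additive_subgroup P M using P by (simp add: subbimodule_def)
  interpret Q: additive_subgroup Q M using Q by (simp add: subbimodule_def)
  have P_carrier: "p \<in> carrier M" if "p \<in> P" for p using that P.a_subset by blast
  have Q_carrier: "q \<in> carrier M" if "q \<in> Q" for q using that Q.a_subset by blast
  have f_bij: "bij_betw f (carrier V) P"
    and f_add: "\<And>x y. \<lbrakk>x \<in> carrier V; y \<in> carrier V\<rbrakk> \<Longrightarrow> f (x \<oplus>\<^bsub>V\<^esub> y) = f x \<oplus>\<^bsub>M\<^esub> f y"
    and f_l: "\<And>r x. \<lbrakk>r \<in> carrier R; x \<in> carrier V\<rbrakk> \<Longrightarrow> f (lsmult V r x) = lsmult M r (f x)"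
    and f_r: "\<And>x s. \<lbrakk>x \<in> carrier V; s \<in> carrier S\<rbrakk> \<Longrightarrow> f (rsmult V x s) = rsmult M (f x) s"
    using f by (auto simp: bimodule_iso_def)
  have f_P: "f x \<in> P" if "x \<in> carrier V" for x
    using f_bij that by (auto simp: bij_betw_def)
  have f_carrier: "f x \<in> carrier M" if "x \<in> carrier V" for x
    using f_P that P_carrier by blast
  have f_hom: "f \<in> bimodule_hom R S V M"
    by (intro bimodule_homI V.abelian_group_axioms abelian_group_axioms f_carrier f_add f_l f_r)
  have decomp: "\<exists>x. x \<in> carrier V \<and> (\<exists>q\<in>Q. u = f x \<oplus>\<^bsub>M\<^esub> q)" if "u \<in> carrier M" for u
  proof -
    have "u \<in> P <+>\<^bsub>M\<^esub> Q" using that PQ(2) by simp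
    then obtain p q where "p \<in> P" "q \<in> Q" "u = p \<oplus>\<^bsub>M\<^esub> q"
      by (auto simp: set_add_def')
    then show ?thesis using f_bij by (auto simp: bij_betw_def)
  qed
  have unique: "x = y"
    if "x \<in> carrier V" "y \<in> carrier V" "q \<in> Q" "q' \<in> Q" "f x \<oplus>\<^bsub>M\<^esub> q = f y \<oplus>\<^bsub>M\<^esub> q'" for x y q q'
  proof -
    have c: "f x \<in> carrier M" "f y \<in> carrier M" "q \<in> carrier M" "q' \<in> carrier M"
      using that f_carrier Q_carrier by auto
    have "f x \<ominus>\<^bsub>M\<^esub> f y = q' \<ominus>\<^bsub>M\<^esub> q"
      using c that(5) by (intro minus_eq_minus_of_add_eq)
    moreover have "f x \<ominus>\<^bsub>M\<^esub> f y \<in> P"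
      using that f_P by (simp add: a_minus_def)
    moreover have "q' \<ominus>\<^bsub>M\<^esub> q \<in> Q"
      using that by (simp add: a_minus_def)
    ultimately have "f x \<ominus>\<^bsub>M\<^esub> f y = \<zero>\<^bsub>M\<^esub>" using PQ(1) by auto
    then have "f x = f y" using c by (metis a_minus_def minus_equality minus_minus a_inv_closed)
    then show ?thesis using f_bij that by (auto simp: bij_betw_def inj_on_def)
  qed
  obtain \<pi> where \<pi>: "\<And>u. u \<in> carrier M \<Longrightarrow> \<pi> u \<in> carrier V \<and> (\<exists>q\<in>Q. u = f (\<pi> u) \<oplus>\<^bsub>M\<^esub> q)"
    using decomp by metis
  have \<pi>_eq: "\<pi> u = x" if "u \<in> carrier M" "x \<in> carrier V" "q \<in> Q" "u = f x \<oplus>\<^bsub>M\<^esub> q" for u x q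
    using \<pi>[OF that(1)] unique that by metis
  have "\<pi> \<in> bimodule_hom R S M V"
  proof (intro bimodule_homI V.abelian_group_axioms abelian_group_axioms)
    fix u assume u: "u \<in> carrier M"
    then show "\<pi> u \<in> carrier V" using \<pi> by blast
    obtain q where q: "q \<in> Q" "u = f (\<pi> u) \<oplus>\<^bsub>M\<^esub> q" using u \<pi> by blast
    have c: "\<pi> u \<in> carrier V" "f (\<pi> u) \<in> carrier M" "q \<in> carrier M"
      using u \<pi> f_carrier Q_carrier q by auto
    show "\<pi> (lsmult M r u) = lsmult V r (\<pi> u)" if r: "r \<in> carrier R" for r
    proof (rule \<pi>_eq)
      show "lsmult M r u = f (lsmult V r (\<pi> u)) \<oplus>\<^bsub>M\<^esub> lsmult M r q"
        by (subst q(2)) (simp add: c r lsmult_add_right f_l)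
      show "lsmult M r q \<in> Q" using Q q(1) r by (simp add: subbimodule_def)
    qed (use u r c lsmult_closed V.lsmult_closed in auto)
    show "\<pi> (rsmult M u s) = rsmult V (\<pi> u) s" if s: "s \<in> carrier S" for s
    proof (rule \<pi>_eq)
      show "rsmult M u s = f (rsmult V (\<pi> u) s) \<oplus>\<^bsub>M\<^esub> rsmult M q s"
        by (subst q(2)) (simp add: c s rsmult_add_left f_r)
      show "rsmult M q s \<in> Q" using Q q(1) s by (simp add: subbimodule_def)
    qed (use u s c rsmult_closed V.rsmult_closed in auto)
    fix v assume v: "v \<in> carrier M"
    obtain q' where q': "q' \<in> Q" "v = f (\<pi> v) \<oplus>\<^bsub>M\<^esub> q'" using v \<pi> by blast
    have d: "\<pi> v \<in> carrier V" "f (\<pi> v) \<in> carrier M" "q' \<in> carrier M"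
      using v \<pi> f_carrier Q_carrier q' by auto
    show "\<pi> (u \<oplus>\<^bsub>M\<^esub> v) = \<pi> u \<oplus>\<^bsub>V\<^esub> \<pi> v"
    proof (rule \<pi>_eq)
      have "u \<oplus>\<^bsub>M\<^esub> v = (f (\<pi> u) \<oplus>\<^bsub>M\<^esub> q) \<oplus>\<^bsub>M\<^esub> (f (\<pi> v) \<oplus>\<^bsub>M\<^esub> q')"
        using q(2) q'(2) by simp
      also have "\<dots> = f (\<pi> u \<oplus>\<^bsub>V\<^esub> \<pi> v) \<oplus>\<^bsub>M\<^esub> (q \<oplus>\<^bsub>M\<^esub> q')"
        using c d by (simp add: f_add a_ac)
      finally show "u \<oplus>\<^bsub>M\<^esub> v = f (\<pi> u \<oplus>\<^bsub>V\<^esub> \<pi> v) \<oplus>\<^bsub>M\<^esub> (q \<oplus>\<^bsub>M\<^esub> q')" .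
    qed (use u v c d q q' in auto)
  qed
  moreover have "\<pi> (f x) = x" if "x \<in> carrier V" for x
    using \<pi>_eq[of "f x" x "\<zero>\<^bsub>M\<^esub>"] that f_carrier by simp
  ultimately show ?rhs using f_hom by blast
next
  interpret V: bimodule R S V by fact
  assume ?rhs
  then obtain \<iota> \<pi> where \<iota>: "\<iota> \<in> bimodule_hom R S V M" and \<pi>: "\<pi> \<in> bimodule_hom R S M V"
    and \<pi>\<iota>: "\<And>x. x \<in> carrier V \<Longrightarrow> \<pi> (\<iota> x) = x" by blast
  interpret \<iota>: abelian_group_hom V M \<iota> using \<iota> by (rule bimodule_homD)
  interpret \<pi>: abelian_group_hom M V \<pi> using \<pi> by (rule bimodule_homD)
  define P where "P = \<iota> ` carrier V"
  define Q where "Q = {u \<in> carrier M. \<pi> u = \<zero>\<^bsub>V\<^esub>}"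
  have "\<zero>\<^bsub>M\<^esub> = \<iota> \<zero>\<^bsub>V\<^esub>" by simp
  then have "\<zero>\<^bsub>M\<^esub> \<in> P" unfolding P_def by blast
  moreover have "\<zero>\<^bsub>M\<^esub> \<in> Q" by (simp add: Q_def)
  moreover have "u = \<zero>\<^bsub>M\<^esub>" if "u \<in> P" "u \<in> Q" for u
    using that \<pi>\<iota> by (auto simp: P_def Q_def)
  ultimately have "P \<inter> Q = {\<zero>\<^bsub>M\<^esub>}" by blast
  moreover have "P <+>\<^bsub>M\<^esub> Q = carrier M"
  proof (intro equalityI subsetI)
    fix u assume u: "u \<in> carrier M"
    let ?p = "\<iota> (\<pi> u)"
    have p: "?p \<in> carrier M" "?p \<in> P" using u by (simp_all add: P_def)
    have "u = ?p \<oplus>\<^bsub>M\<^esub> (u \<ominus>\<^bsub>M\<^esub> ?p)"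
      using u p(1) by (simp add: a_minus_def a_lcomm[of ?p] r_neg)
    moreover have "u \<ominus>\<^bsub>M\<^esub> ?p \<in> Q"
      using u p(1) \<pi>\<iota> by (simp add: Q_def a_minus_def V.r_neg)
    ultimately show "u \<in> P <+>\<^bsub>M\<^esub> Q" using p(2) unfolding set_add_def' by blast
  qed (auto simp: set_add_def' P_def Q_def)
  moreover have "\<iota> \<in> bimodule_iso R S V (M\<lparr>carrier := P\<rparr>)"
    using bimodule_homD[OF \<iota>] \<pi>\<iota>
    by (auto simp: bimodule_iso_def P_def bij_betw_def inj_on_def) metis
  ultimately show ?lhs
    using kernel_subbimodule[OF assms \<pi>] image_subbimodule[OF assms \<iota>]
    unfolding iso_to_direct_summand_def direct_summand_def P_def[symmetric] Q_def[symmetric]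
    by blast
qed

lemma power_bimodule_simps:
  "carrier (power_bimodule n M) = {..<n} \<rightarrow>\<^sub>E carrier M"
  "\<zero>\<^bsub>power_bimodule n M\<^esub> = (\<lambda>i\<in>{..<n}. \<zero>\<^bsub>M\<^esub>)"
  "u \<oplus>\<^bsub>power_bimodule n M\<^esub> v = (\<lambda>i\<in>{..<n}. u i \<oplus>\<^bsub>M\<^esub> v i)"
  "rsmult (power_bimodule n M) u s = (\<lambda>i\<in>{..<n}. rsmult M (u i) s)"
  "lsmult (power_bimodule n M) r u = (\<lambda>i\<in>{..<n}. lsmult M r (u i))"
  by (simp_all add: power_bimodule_def)

lemma (in bimodule) bimodule_power: "bimodule R S (power_bimodule n M)"
proof -
  have "abelian_group (power_bimodule n M)"
  proof (rule abelian_groupI)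
    fix u assume u: "u \<in> carrier (power_bimodule n M)"
    have "(\<lambda>i\<in>{..<n}. \<ominus>\<^bsub>M\<^esub> u i) \<in> carrier (power_bimodule n M)"
      and "(\<lambda>i\<in>{..<n}. \<ominus>\<^bsub>M\<^esub> u i) \<oplus>\<^bsub>power_bimodule n M\<^esub> u = \<zero>\<^bsub>power_bimodule n M\<^esub>"
      using u by (auto simp: power_bimodule_simps PiE_def Pi_def l_neg cong: restrict_cong)
    then show "\<exists>v\<in>carrier (power_bimodule n M).
        v \<oplus>\<^bsub>power_bimodule n M\<^esub> u = \<zero>\<^bsub>power_bimodule n M\<^esub>" by blast
    show "\<zero>\<^bsub>power_bimodule n M\<^esub> \<oplus>\<^bsub>power_bimodule n M\<^esub> u = u"
      using u by (auto simp: power_bimodule_simps PiE_def Pi_def extensional_def fun_eq_iff)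
  qed (auto simp: power_bimodule_simps PiE_def Pi_def a_ac cong: restrict_cong)
  then interpret P: abelian_group "power_bimodule n M" .
  show ?thesis
    by unfold_locales
      (auto simp: power_bimodule_simps PiE_def Pi_def extensional_def fun_eq_iff
        rsmult_closed rsmult_add_left rsmult_add_right rsmult_assoc rsmult_one
        lsmult_closed lsmult_add_left lsmult_add_right lsmult_assoc lsmult_one lsmult_rsmult)
qed

text \<open>
  A map into a power is a family of maps, a map out of a power is a sum of maps, so a retraction
  of \<open>M\<^sup>n\<close> onto \<open>V\<close> amounts to a factorization of the identity of \<open>V\<close> through \<open>n\<close> copies of
  \<open>M\<close>.
\<close>

lemma (in bimodule) iso_to_direct_summand_power_iff:
  assumes "bimodule R S V"
  shows "iso_to_direct_summand R S V (power_bimodule n M) \<longleftrightarrow>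
    (\<exists>\<iota> \<pi>. (\<forall>i<n. \<iota> i \<in> bimodule_hom R S V M \<and> \<pi> i \<in> bimodule_hom R S M V) \<and>
      (\<forall>x\<in>carrier V. (\<Oplus>\<^bsub>V\<^esub>i\<in>{..<n}. \<pi> i (\<iota> i x)) = x))"
    (is "?lhs \<longleftrightarrow> ?rhs")
proof -
  let ?P = "power_bimodule n M"
  interpret V: bimodule R S V by fact
  interpret P: bimodule R S ?P by (rule bimodule_power)
  have component: "(\<lambda>u. u i) \<in> bimodule_hom R S ?P M" if "i < n" for i
    using that
    by (intro bimodule_homI P.abelian_group_axioms abelian_group_axioms)
      (auto simp: power_bimodule_simps)
  define single where "single i x = (\<lambda>j\<in>{..<n}. if j = i then x else \<zero>\<^bsub>M\<^esub>)" for i x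
  have single: "single i \<in> bimodule_hom R S M ?P" for i
    using abelian_group_hom.hom_zero[OF lsmult_hom] abelian_group_hom.hom_zero[OF rsmult_hom]
    by (intro bimodule_homI P.abelian_group_axioms abelian_group_axioms)
      (auto simp: power_bimodule_simps single_def fun_eq_iff)
  have expansion: "u = (\<Oplus>\<^bsub>?P\<^esub>i\<in>{..<n}. single i (u i))" if u: "u \<in> carrier ?P" for u
  proof -
    have s: "(\<lambda>i. single i (u i)) \<in> {..<n} \<rightarrow> carrier ?P"
      using u component single by (auto dest!: bimodule_homD(2))
    have ui: "u i \<in> carrier M" if "i < n" for i
      using that u by (auto simp: power_bimodule_simps)
    have eq: "(\<Oplus>\<^bsub>?P\<^esub>i\<in>{..<n}. single i (u i)) j = u j" if j: "j < n" for j
    proof -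
      have "(\<Oplus>\<^bsub>?P\<^esub>i\<in>{..<n}. single i (u i)) j = (\<Oplus>\<^bsub>M\<^esub>i\<in>{..<n}. single i (u i) j)"
        by (rule abelian_group_hom.hom_finsum[OF bimodule_homD(1)[OF component[OF j]] s])
      also have "\<dots> = (\<Oplus>\<^bsub>M\<^esub>i\<in>{..<n}. if j = i then u i else \<zero>\<^bsub>M\<^esub>)"
        using ui j by (intro finsum_cong') (simp_all add: single_def Pi_def)
      also have "\<dots> = u j"
        using ui j by (intro finsum_singleton) simp_all
      finally show ?thesis .
    qed
    have c: "(\<Oplus>\<^bsub>?P\<^esub>i\<in>{..<n}. single i (u i)) \<in> carrier ?P"
      using s by (rule P.finsum_closed)
    show ?thesis
      by (rule PiE_ext[OF u[unfolded power_bimodule_simps(1)] c[unfolded power_bimodule_simps(1)]])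
        (simp add: eq)
  qed
  show ?thesis
    unfolding P.iso_to_direct_summand_iff_retract[OF assms]
  proof
    assume "\<exists>\<iota>\<in>bimodule_hom R S V ?P. \<exists>\<pi>\<in>bimodule_hom R S ?P V. \<forall>x\<in>carrier V. \<pi> (\<iota> x) = x"
    then obtain \<iota> \<pi> where \<iota>: "\<iota> \<in> bimodule_hom R S V ?P" and \<pi>: "\<pi> \<in> bimodule_hom R S ?P V"
      and \<pi>\<iota>: "\<And>x. x \<in> carrier V \<Longrightarrow> \<pi> (\<iota> x) = x" by blast
    show ?rhs
    proof (intro exI conjI allI impI ballI)
      fix i assume i: "i < n"
      show "(\<lambda>x. \<iota> x i) \<in> bimodule_hom R S V M"
        by (intro bimodule_homI V.abelian_group_axioms abelian_group_axioms)
          (simp_all add: bimodule_homD(2-5)[OF \<iota>] bimodule_homD(2-5)[OF component[OF i]])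
      show "(\<lambda>x. \<pi> (single i x)) \<in> bimodule_hom R S M V"
        by (intro bimodule_homI V.abelian_group_axioms abelian_group_axioms)
          (simp_all add: bimodule_homD(2-5)[OF \<pi>] bimodule_homD(2-5)[OF single])
    next
      fix x assume x: "x \<in> carrier V"
      have \<iota>x: "\<iota> x \<in> carrier ?P" using \<iota> x by (rule bimodule_homD)
      then have s: "(\<lambda>i. single i (\<iota> x i)) \<in> {..<n} \<rightarrow> carrier ?P"
        using component single by (auto dest!: bimodule_homD(2))
      have "(\<Oplus>\<^bsub>V\<^esub>i\<in>{..<n}. \<pi> (single i (\<iota> x i))) = \<pi> (\<Oplus>\<^bsub>?P\<^esub>i\<in>{..<n}. single i (\<iota> x i))"
        using abelian_group_hom.hom_finsum[OF bimodule_homD(1)[OF \<pi>] s] by simp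
      also have "\<dots> = x" using expansion[OF \<iota>x] \<pi>\<iota>[OF x] by simp
      finally show "(\<Oplus>\<^bsub>V\<^esub>i\<in>{..<n}. \<pi> (single i (\<iota> x i))) = x" .
    qed
  next
    assume ?rhs
    then obtain \<iota> \<pi> where \<iota>: "\<And>i. i < n \<Longrightarrow> \<iota> i \<in> bimodule_hom R S V M"
      and \<pi>: "\<And>i. i < n \<Longrightarrow> \<pi> i \<in> bimodule_hom R S M V"
      and \<pi>\<iota>: "\<And>x. x \<in> carrier V \<Longrightarrow> (\<Oplus>\<^bsub>V\<^esub>i\<in>{..<n}. \<pi> i (\<iota> i x)) = x" by blast
    let ?\<iota> = "\<lambda>x. \<lambda>i\<in>{..<n}. \<iota> i x"
    let ?\<pi> = "\<lambda>u. \<Oplus>\<^bsub>V\<^esub>i\<in>{..<n}. \<pi> i (u i)"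
    have \<iota>_hom: "?\<iota> \<in> bimodule_hom R S V ?P"
      by (intro bimodule_homI V.abelian_group_axioms P.abelian_group_axioms)
        (simp_all add: power_bimodule_simps bimodule_homD(2-5)[OF \<iota>] cong: restrict_cong)
    have \<pi>_hom: "?\<pi> \<in> bimodule_hom R S ?P V"
    proof (intro bimodule_homI V.abelian_group_axioms P.abelian_group_axioms)
      have c: "(\<lambda>i. \<pi> i (u i)) \<in> {..<n} \<rightarrow> carrier V" if "u \<in> carrier ?P" for u
        using that bimodule_homD(2)[OF \<pi>] by (auto simp: power_bimodule_simps)
      fix u assume u: "u \<in> carrier ?P"
      then show "?\<pi> u \<in> carrier V" using c by (intro V.finsum_closed)
      have ui: "u i \<in> carrier M" if "i < n" for i
        using u that by (auto simp: power_bimodule_simps)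
      show "?\<pi> (lsmult ?P r u) = lsmult V r (?\<pi> u)" if r: "r \<in> carrier R" for r
        unfolding abelian_group_hom.hom_finsum[OF V.lsmult_hom[OF r] c[OF u]]
        using ui r by (intro V.finsum_cong')
          (simp_all add: power_bimodule_simps V.lsmult_closed Pi_def bimodule_homD(2,4)[OF \<pi>])
      show "?\<pi> (rsmult ?P u s) = rsmult V (?\<pi> u) s" if s: "s \<in> carrier S" for s
        unfolding abelian_group_hom.hom_finsum[OF V.rsmult_hom[OF s] c[OF u]]
        using ui s by (intro V.finsum_cong')
          (simp_all add: power_bimodule_simps V.rsmult_closed Pi_def bimodule_homD(2,5)[OF \<pi>])
      fix v assume v: "v \<in> carrier ?P"
      have vi: "v i \<in> carrier M" if "i < n" for i
        using v that by (auto simp: power_bimodule_simps)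
      show "?\<pi> (u \<oplus>\<^bsub>?P\<^esub> v) = ?\<pi> u \<oplus>\<^bsub>V\<^esub> ?\<pi> v"
        unfolding V.finsum_addf[OF c[OF u] c[OF v], symmetric]
        using ui vi by (intro V.finsum_cong')
          (simp_all add: power_bimodule_simps Pi_def bimodule_homD(2,3)[OF \<pi>])
    qed
    have "?\<pi> (?\<iota> x) = x" if x: "x \<in> carrier V" for x
    proof -
      have "?\<pi> (?\<iota> x) = (\<Oplus>\<^bsub>V\<^esub>i\<in>{..<n}. \<pi> i (\<iota> i x))"
        using x by (intro V.finsum_cong')
          (simp_all add: Pi_def bimodule_homD(2)[OF \<pi>] bimodule_homD(2)[OF \<iota>])
      then show ?thesis using \<pi>\<iota>[OF x] by simp
    qed
    then show "\<exists>\<iota>\<in>bimodule_hom R S V ?P. \<exists>\<pi>\<in>bimodule_hom R S ?P V.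
        \<forall>x\<in>carrier V. \<pi> (\<iota> x) = x"
      by (intro bexI[OF _ \<iota>_hom] bexI[OF _ \<pi>_hom] ballI)
  qed
qed


section \<open>Tensor products\<close>

definition tensor ::
  "('b, 'k) ring_scheme \<Rightarrow> ('b, 'm, 'r, 'e) bimodule_scheme \<Rightarrow>
    ('s, 'n, 'b, 'f) bimodule_scheme \<Rightarrow> 'm \<Rightarrow> 'n \<Rightarrow> ('m \<times> 'n \<Rightarrow>\<^sub>0 int) set" where
  "tensor B M N x y =
    tensor_kernel B M N #>\<^bsub>free_Abelian_group (carrier M \<times> carrier N)\<^esub> frag_of (x, y)"

text \<open>
  The choice is unambiguous on the tensor product, because pure tensors generate it.
\<close>

definition tensor_lift ::
  "('b, 'k) ring_scheme \<Rightarrow> ('b, 'm, 'r, 'e) bimodule_scheme \<Rightarrow>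
    ('s, 'n, 'b, 'f) bimodule_scheme \<Rightarrow> ('g, 'h) ring_scheme \<Rightarrow> ('m \<Rightarrow> 'n \<Rightarrow> 'g) \<Rightarrow>
    ('m \<times> 'n \<Rightarrow>\<^sub>0 int) set \<Rightarrow> 'g" where
  "tensor_lift B M N G b = (SOME f. abelian_group_hom (tensor_bimodule B M N) G f \<and>
    (\<forall>x\<in>carrier M. \<forall>y\<in>carrier N. f (tensor B M N x y) = b x y))"

locale bimodule_pair = M: bimodule R B M + N: bimodule B S N
  for R :: "('r, 'k) ring_scheme" and B :: "('b, 'l) ring_scheme"
    and S :: "('s, 'p) ring_scheme"
    and M :: "('b, 'm, 'r, 'e) bimodule_scheme" and N :: "('s, 'n, 'b, 'f) bimodule_scheme"
begin

abbreviation "free \<equiv> free_Abelian_group (carrier M \<times> carrier N)"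
abbreviation "K \<equiv> tensor_kernel B M N"
abbreviation "T \<equiv> tensor_bimodule B M N"
abbreviation "coset u \<equiv> K #>\<^bsub>free\<^esub> u"

lemma free_diff_closed:
  "\<lbrakk>u \<in> carrier free; v \<in> carrier free\<rbrakk> \<Longrightarrow> u - v \<in> carrier free"
  using keys_diff[of u v] by auto

lemma tensor_relations_subset: "tensor_relations B M N \<subseteq> carrier free"
proof -
  have "frag_of p - frag_of q \<in> carrier free" "frag_of p - frag_of q - frag_of r \<in> carrier free"
    if "p \<in> carrier M \<times> carrier N" "q \<in> carrier M \<times> carrier N" "r \<in> carrier M \<times> carrier N"
    for p q r
    using that by (intro free_diff_closed; simp)+
  then show ?thesis
    unfolding tensor_relations_def
    by (auto simp: M.rsmult_closed N.lsmult_closed simp del: carrier_free_Abelian_group_iff)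
qed

lemma comm_group_free: "comm_group free"
  by (rule abelian_free_Abelian_group)

lemma subgroup_K: "subgroup K free"
  unfolding tensor_kernel_def
  by (intro group.generate_is_subgroup tensor_relations_subset group_free_Abelian_group)

lemma normal_K: "K \<lhd> free"
  by (intro comm_group.subgroup_imp_normal comm_group_free subgroup_K)

lemma K_subset: "subgroup H free \<Longrightarrow> tensor_relations B M N \<subseteq> H \<Longrightarrow> K \<subseteq> H"
  unfolding tensor_kernel_def
  by (intro group.generate_subgroup_incl group_free_Abelian_group)

lemma coset_eqI:
  assumes "u \<in> carrier free" "v \<in> carrier free" "u - v \<in> tensor_relations B M N"
  shows "coset u = coset v"
proof -
  have "u \<otimes>\<^bsub>free\<^esub> inv\<^bsub>free\<^esub> v \<in> K"
    using assms unfolding tensor_kernel_def by (auto intro: generate.incl)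
  then have "u \<in> coset v"
    using subgroup.rcos_module[OF subgroup_K group_free_Abelian_group] assms by blast
  then show ?thesis
    using group.repr_independence[OF group_free_Abelian_group _ assms(2) subgroup_K] by simp
qed

lemma carrier_T: "carrier T = coset ` carrier free"
  by (simp add: tensor_bimodule_def Let_def carrier_FactGroup)

lemma coset_closed: "u \<in> carrier free \<Longrightarrow> coset u \<in> carrier T"
  by (simp add: carrier_T del: carrier_free_Abelian_group_iff)

lemma coset_add:
  "\<lbrakk>u \<in> carrier free; v \<in> carrier free\<rbrakk> \<Longrightarrow> coset u \<oplus>\<^bsub>T\<^esub> coset v = coset (u + v)"
  using normal.rcos_sum[OF normal_K, of u v] by (simp add: tensor_bimodule_def Let_def)

lemma zero_T: "\<zero>\<^bsub>T\<^esub> = coset 0"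
  using group.coset_mult_one[OF group_free_Abelian_group subgroup.subset[OF subgroup_K]]
  by (simp add: tensor_bimodule_def Let_def)

lemma free_add_closed:
  "\<lbrakk>u \<in> carrier free; v \<in> carrier free\<rbrakk> \<Longrightarrow> u + v \<in> carrier free"
  using keys_add[of u v] by auto

lemma abelian_group_T: "abelian_group T"
proof (rule abelian_groupI)
  fix s assume "s \<in> carrier T"
  then obtain u where u: "u \<in> carrier free" "s = coset u" unfolding carrier_T by blast
  show "\<zero>\<^bsub>T\<^esub> \<oplus>\<^bsub>T\<^esub> s = s"
    using u by (simp add: zero_T coset_add)
  have "coset (- u) \<in> carrier T" "coset (- u) \<oplus>\<^bsub>T\<^esub> s = \<zero>\<^bsub>T\<^esub>"
    using u coset_closed[of "- u"] by (simp_all add: zero_T coset_add)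
  then show "\<exists>t\<in>carrier T. t \<oplus>\<^bsub>T\<^esub> s = \<zero>\<^bsub>T\<^esub>" by blast
  fix t assume "t \<in> carrier T"
  then obtain v where v: "v \<in> carrier free" "t = coset v" unfolding carrier_T by blast
  show "s \<oplus>\<^bsub>T\<^esub> t \<in> carrier T"
    using u v coset_closed[OF free_add_closed[OF u(1) v(1)]] by (simp add: coset_add)
  show "s \<oplus>\<^bsub>T\<^esub> t = t \<oplus>\<^bsub>T\<^esub> s"
    using u v by (simp add: coset_add add.commute)
  fix r assume "r \<in> carrier T"
  then obtain w where w: "w \<in> carrier free" "r = coset w" unfolding carrier_T by blast
  show "s \<oplus>\<^bsub>T\<^esub> t \<oplus>\<^bsub>T\<^esub> r = s \<oplus>\<^bsub>T\<^esub> (t \<oplus>\<^bsub>T\<^esub> r)"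
    unfolding u(2) v(2) w(2) using u(1) v(1) w(1)
    by (simp only: coset_add free_add_closed add.assoc)
next
  show "\<zero>\<^bsub>T\<^esub> \<in> carrier T" unfolding zero_T by (intro coset_closed) simp
qed

sublocale T: abelian_group T by (rule abelian_group_T)

lemma tensor_closed:
  "\<lbrakk>x \<in> carrier M; y \<in> carrier N\<rbrakk> \<Longrightarrow> tensor B M N x y \<in> carrier T"
  unfolding tensor_def by (intro coset_closed) simp

lemma tensor_add_left:
  assumes "x \<in> carrier M" "x' \<in> carrier M" "y \<in> carrier N"
  shows "tensor B M N (x \<oplus>\<^bsub>M\<^esub> x') y = tensor B M N x y \<oplus>\<^bsub>T\<^esub> tensor B M N x' y"
proof -
  have "frag_of (x \<oplus>\<^bsub>M\<^esub> x', y) - (frag_of (x, y) + frag_of (x', y)) \<in> tensor_relations B M N"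
    using assms unfolding tensor_relations_def diff_diff_add[symmetric] by blast
  moreover have "frag_of (x, y) + frag_of (x', y) \<in> carrier free"
    using assms keys_add[of "frag_of (x, y)" "frag_of (x', y)"] by auto
  ultimately have "coset (frag_of (x \<oplus>\<^bsub>M\<^esub> x', y)) = coset (frag_of (x, y) + frag_of (x', y))"
    using assms by (intro coset_eqI) simp_all
  then show ?thesis
    using assms by (simp add: tensor_def coset_add)
qed

lemma tensor_add_right:
  assumes "x \<in> carrier M" "y \<in> carrier N" "y' \<in> carrier N"
  shows "tensor B M N x (y \<oplus>\<^bsub>N\<^esub> y') = tensor B M N x y \<oplus>\<^bsub>T\<^esub> tensor B M N x y'"
proof -
  have "frag_of (x, y \<oplus>\<^bsub>N\<^esub> y') - (frag_of (x, y) + frag_of (x, y')) \<in> tensor_relations B M N"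
    using assms unfolding tensor_relations_def diff_diff_add[symmetric] by blast
  moreover have "frag_of (x, y) + frag_of (x, y') \<in> carrier free"
    using assms keys_add[of "frag_of (x, y)" "frag_of (x, y')"] by auto
  ultimately have "coset (frag_of (x, y \<oplus>\<^bsub>N\<^esub> y')) = coset (frag_of (x, y) + frag_of (x, y'))"
    using assms by (intro coset_eqI) simp_all
  then show ?thesis
    using assms by (simp add: tensor_def coset_add)
qed

lemma tensor_balanced:
  assumes "x \<in> carrier M" "b \<in> carrier B" "y \<in> carrier N"
  shows "tensor B M N (rsmult M x b) y = tensor B M N x (lsmult N b y)"
proof -
  have "frag_of (rsmult M x b, y) - frag_of (x, lsmult N b y) \<in> tensor_relations B M N"
    using assms unfolding tensor_relations_def by blast
  then show ?thesis
    using assms unfolding tensor_def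
    by (intro coset_eqI) (simp_all add: M.rsmult_closed N.lsmult_closed)
qed

lemma tensor_hom_left: "y \<in> carrier N \<Longrightarrow> abelian_group_hom M T (\<lambda>x. tensor B M N x y)"
  by (intro abelian_group_hom_of_additive M.abelian_group_axioms abelian_group_T
      tensor_closed tensor_add_left)

text \<open>
  Since \<open>-(x \<otimes> y) = (-x) \<otimes> y\<close>, sums of pure tensors already exhaust the tensor product. The
  induction over the free group carries \<open>P\<close> for an element and its negative at once, as the
  free group is generated by differences.
\<close>

lemma tensor_induct [consumes 1, case_names tensor add]:
  assumes "t \<in> carrier T"
    and tensor: "\<And>x y. \<lbrakk>x \<in> carrier M; y \<in> carrier N\<rbrakk> \<Longrightarrow> P (tensor B M N x y)"
    and add: "\<And>s t. \<lbrakk>s \<in> carrier T; t \<in> carrier T; P s; P t\<rbrakk> \<Longrightarrow> P (s \<oplus>\<^bsub>T\<^esub> t)"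
  shows "P t"
proof -
  obtain u where u: "Poly_Mapping.keys u \<subseteq> carrier M \<times> carrier N" and t: "t = coset u"
    using assms(1) by (auto simp: carrier_T)
  from u have "P (coset u) \<and> P (coset (- u))"
  proof (induction rule: free_Abelian_group_induct[consumes 1, case_names zero diff of])
    case zero
    have "tensor B M N \<zero>\<^bsub>M\<^esub> \<zero>\<^bsub>N\<^esub> = \<zero>\<^bsub>T\<^esub>"
      using abelian_group_hom.hom_zero[OF tensor_hom_left] by simp
    then have "P \<zero>\<^bsub>T\<^esub>" using tensor[of "\<zero>\<^bsub>M\<^esub>" "\<zero>\<^bsub>N\<^esub>"] by simp
    then show ?case by (simp add: zero_T)
  next
    case (diff a b)
    have ab: "coset (a - b) = coset a \<oplus>\<^bsub>T\<^esub> coset (- b)"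
      "coset (- (a - b)) = coset b \<oplus>\<^bsub>T\<^esub> coset (- a)"
      using diff(1,2) coset_add[of a "- b"] coset_add[of b "- a"] by simp_all
    show ?case
      unfolding ab using diff by (intro conjI add coset_closed) simp_all
  next
    case (of p)
    then obtain x y where p: "p = (x, y)" "x \<in> carrier M" "y \<in> carrier N" by auto
    have "coset (- frag_of p) \<oplus>\<^bsub>T\<^esub> coset (frag_of p) = \<zero>\<^bsub>T\<^esub>"
      using p by (simp add: coset_add zero_T)
    then have "coset (- frag_of p) = \<ominus>\<^bsub>T\<^esub> coset (frag_of p)"
      using p by (intro T.minus_equality[symmetric] coset_closed) simp_all
    also have "\<dots> = tensor B M N (\<ominus>\<^bsub>M\<^esub> x) y"
      using abelian_group_hom.hom_a_inv[OF tensor_hom_left[OF p(3)] p(2)] p(1)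
      by (simp add: tensor_def)
    finally show ?case
      using tensor[of x y] tensor[of "\<ominus>\<^bsub>M\<^esub> x" y] p by (simp add: tensor_def)
  qed
  then show ?thesis using t by simp
qed

lemma frag_extend_closed:
  assumes "v \<in> carrier free" and f: "\<And>p. p \<in> carrier M \<times> carrier N \<Longrightarrow> f p \<in> carrier free"
  shows "frag_extend f v \<in> carrier free"
proof -
  have "Poly_Mapping.keys (f p) \<subseteq> carrier M \<times> carrier N" if "p \<in> Poly_Mapping.keys v" for p
    using that assms(1) f[of p] by auto
  then have "(\<Union>p\<in>Poly_Mapping.keys v. Poly_Mapping.keys (f p)) \<subseteq> carrier M \<times> carrier N"
    by (rule UN_least)
  with keys_frag_extend[of f v] show ?thesis
    unfolding carrier_free_Abelian_group_iff by (rule subset_trans)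
qed

text \<open>
  An endomorphism of the free abelian group that maps the relations into \<open>K\<close> maps \<open>K\<close> into
  itself, and adding \<open>K\<close> to the image of a coset then gives the coset of the image of any
  representative.
\<close>

lemma frag_extend_coset:
  assumes f: "\<And>p. p \<in> carrier M \<times> carrier N \<Longrightarrow> f p \<in> carrier free"
    and rel: "\<And>v. v \<in> tensor_relations B M N \<Longrightarrow> frag_extend f v \<in> K"
    and u: "u \<in> carrier free"
  shows "K <#>\<^bsub>free\<^esub> frag_extend f ` coset u = coset (frag_extend f u)"
proof -
  have closed: "frag_extend f v \<in> carrier free" if "v \<in> carrier free" for v
    using that f by (rule frag_extend_closed)
  interpret K: subgroup K free by (rule subgroup_K)
  have K_carrier: "v \<in> carrier free" if "v \<in> K" for v using that by (rule K.mem_carrier)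
  have K_add: "v + w \<in> K" if "v \<in> K" "w \<in> K" for v w
    using K.m_closed that by simp
  have K_minus: "- v \<in> K" if "v \<in> K" for v
    using K.m_inv_closed[OF that] K_carrier[OF that] by simp
  have "subgroup {v \<in> carrier free. frag_extend f v \<in> K} free"
  proof (rule group.subgroupI[OF group_free_Abelian_group])
    show "{v \<in> carrier free. frag_extend f v \<in> K} \<noteq> {}"
      using K.one_closed by (auto intro!: exI[of _ 0])
    fix v assume v: "v \<in> {v \<in> carrier free. frag_extend f v \<in> K}"
    then show "inv\<^bsub>free\<^esub> v \<in> {v \<in> carrier free. frag_extend f v \<in> K}"
      by (auto simp: frag_extend_minus K_minus)
    fix w assume "w \<in> {v \<in> carrier free. frag_extend f v \<in> K}"
    with v show "v \<otimes>\<^bsub>free\<^esub> w \<in> {v \<in> carrier free. frag_extend f v \<in> K}"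
      using free_add_closed by (auto simp: frag_extend_add K_add)
  qed auto
  then have "K \<subseteq> {v \<in> carrier free. frag_extend f v \<in> K}"
    using tensor_relations_subset rel by (intro K_subset) blast+
  then have K_K: "frag_extend f v \<in> K" if "v \<in> K" for v using that by blast
  show ?thesis
  proof (intro equalityI subsetI)
    fix w assume "w \<in> K <#>\<^bsub>free\<^esub> frag_extend f ` coset u"
    then obtain k k' where "k \<in> K" "k' \<in> K" "w = k + frag_extend f (k' + u)"
      unfolding set_mult_def r_coset_def by auto
    then have "k + frag_extend f k' \<in> K" "w = (k + frag_extend f k') + frag_extend f u"
      by (simp_all add: K_K K_add frag_extend_add)
    then show "w \<in> coset (frag_extend f u)"
      unfolding r_coset_def by auto
  next
    fix w assume "w \<in> coset (frag_extend f u)"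
    then obtain k where k: "k \<in> K" "w = k + frag_extend f u"
      unfolding r_coset_def by auto
    have "u \<in> coset u"
      using group.rcos_self[OF group_free_Abelian_group u subgroup_K] .
    then show "w \<in> K <#>\<^bsub>free\<^esub> frag_extend f ` coset u"
      unfolding set_mult_def using k by auto
  qed
qed

lemma relation_in_K: "v \<in> tensor_relations B M N \<Longrightarrow> v \<in> K"
  unfolding tensor_kernel_def by (rule generate.incl)

lemma lsmult_coset:
  assumes r: "r \<in> carrier R" and u: "u \<in> carrier free"
  shows "lsmult T r (coset u) = coset (frag_extend (\<lambda>(x, y). frag_of (lsmult M r x, y)) u)"
proof -
  let ?f = "\<lambda>(x, y). frag_of (lsmult M r x, y)"
  have "frag_extend ?f v \<in> K" if "v \<in> tensor_relations B M N" for v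
  proof -
    have "frag_extend ?f v \<in> tensor_relations B M N"
      using that unfolding tensor_relations_def
    proof (elim UnE, goal_cases)
      case 1
      then show ?case
        using r by (intro UnI1) (force simp: frag_extend_diff M.lsmult_closed M.lsmult_add_right)
    next
      case 2
      then show ?case
        using r by (intro UnI1[OF UnI2]) (force simp: frag_extend_diff M.lsmult_closed)
    next
      case 3
      then show ?case
        using r by (intro UnI2) (force simp: frag_extend_diff M.lsmult_closed M.lsmult_rsmult[symmetric])
    qed
    then show ?thesis by (rule relation_in_K)
  qed
  then have "K <#>\<^bsub>free\<^esub> frag_extend ?f ` coset u = coset (frag_extend ?f u)"
    using r u by (intro frag_extend_coset) (auto simp: M.lsmult_closed)
  then show ?thesis by (simp add: tensor_bimodule_def Let_def)
qed

lemma rsmult_coset: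
  assumes s: "s \<in> carrier S" and u: "u \<in> carrier free"
  shows "rsmult T (coset u) s = coset (frag_extend (\<lambda>(x, y). frag_of (x, rsmult N y s)) u)"
proof -
  let ?f = "\<lambda>(x, y). frag_of (x, rsmult N y s)"
  have "frag_extend ?f v \<in> K" if "v \<in> tensor_relations B M N" for v
  proof -
    have "frag_extend ?f v \<in> tensor_relations B M N"
      using that unfolding tensor_relations_def
    proof (elim UnE, goal_cases)
      case 1
      then show ?case
        using s by (intro UnI1) (force simp: frag_extend_diff N.rsmult_closed)
    next
      case 2
      then show ?case
        using s by (intro UnI1[OF UnI2]) (force simp: frag_extend_diff N.rsmult_closed N.rsmult_add_left)
    next
      case 3
      then show ?case
        using s by (intro UnI2) (force simp: frag_extend_diff N.rsmult_closed N.lsmult_rsmult)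
    qed
    then show ?thesis by (rule relation_in_K)
  qed
  then have "K <#>\<^bsub>free\<^esub> frag_extend ?f ` coset u = coset (frag_extend ?f u)"
    using s u by (intro frag_extend_coset) (auto simp: N.rsmult_closed)
  then show ?thesis by (simp add: tensor_bimodule_def Let_def)
qed

lemma lsmult_tensor:
  "\<lbrakk>r \<in> carrier R; x \<in> carrier M; y \<in> carrier N\<rbrakk> \<Longrightarrow>
    lsmult T r (tensor B M N x y) = tensor B M N (lsmult M r x) y"
  unfolding tensor_def by (subst lsmult_coset) simp_all

lemma rsmult_tensor:
  "\<lbrakk>s \<in> carrier S; x \<in> carrier M; y \<in> carrier N\<rbrakk> \<Longrightarrow>
    rsmult T (tensor B M N x y) s = tensor B M N x (rsmult N y s)"
  unfolding tensor_def by (subst rsmult_coset) simp_all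

lemma lsmult_T_hom: "r \<in> carrier R \<Longrightarrow> abelian_group_hom T T (lsmult T r)"
proof (intro abelian_group_hom_of_additive abelian_group_T)
  fix s assume r: "r \<in> carrier R" and "s \<in> carrier T"
  then obtain u where u: "u \<in> carrier free" "s = coset u" unfolding carrier_T by blast
  have closed: "frag_extend (\<lambda>(x, y). frag_of (lsmult M r x, y)) v \<in> carrier free"
    if "v \<in> carrier free" for v
    using r by (intro frag_extend_closed that) (auto simp: M.lsmult_closed)
  show "lsmult T r s \<in> carrier T"
    unfolding u(2) lsmult_coset[OF r u(1)] by (intro coset_closed closed u(1))
  fix t assume "t \<in> carrier T"
  then obtain v where v: "v \<in> carrier free" "t = coset v" unfolding carrier_T by blast
  show "lsmult T r (s \<oplus>\<^bsub>T\<^esub> t) = lsmult T r s \<oplus>\<^bsub>T\<^esub> lsmult T r t"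
    unfolding u(2) v(2) coset_add[OF u(1) v(1)] lsmult_coset[OF r u(1)] lsmult_coset[OF r v(1)]
      lsmult_coset[OF r free_add_closed[OF u(1) v(1)]] coset_add[OF closed closed, OF u(1) v(1)]
      frag_extend_add ..
qed

lemma rsmult_T_hom: "s \<in> carrier S \<Longrightarrow> abelian_group_hom T T (\<lambda>t. rsmult T t s)"
proof (intro abelian_group_hom_of_additive abelian_group_T)
  fix t assume s: "s \<in> carrier S" and "t \<in> carrier T"
  then obtain u where u: "u \<in> carrier free" "t = coset u" unfolding carrier_T by blast
  have closed: "frag_extend (\<lambda>(x, y). frag_of (x, rsmult N y s)) v \<in> carrier free"
    if "v \<in> carrier free" for v
    using s by (intro frag_extend_closed that) (auto simp: N.rsmult_closed)
  show "rsmult T t s \<in> carrier T"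
    unfolding u(2) rsmult_coset[OF s u(1)] by (intro coset_closed closed u(1))
  fix t' assume "t' \<in> carrier T"
  then obtain v where v: "v \<in> carrier free" "t' = coset v" unfolding carrier_T by blast
  show "rsmult T (t \<oplus>\<^bsub>T\<^esub> t') s = rsmult T t s \<oplus>\<^bsub>T\<^esub> rsmult T t' s"
    unfolding u(2) v(2) coset_add[OF u(1) v(1)] rsmult_coset[OF s u(1)] rsmult_coset[OF s v(1)]
      rsmult_coset[OF s free_add_closed[OF u(1) v(1)]] coset_add[OF closed closed, OF u(1) v(1)]
      frag_extend_add ..
qed

lemma bimodule_T: "bimodule R S T"
proof -
  note lc = abelian_group_hom.hom_closed[OF lsmult_T_hom]
    and la = abelian_group_hom.hom_add[OF lsmult_T_hom]
    and rc = abelian_group_hom.hom_closed[OF rsmult_T_hom]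
    and ra = abelian_group_hom.hom_add[OF rsmult_T_hom]
  note simps = lc la rc ra lsmult_tensor rsmult_tensor tensor_closed
    M.lsmult_closed N.rsmult_closed T.a_ac
  have "right_module_axioms S T"
  proof (unfold_locales)
    fix t assume t: "t \<in> carrier T"
    show "rsmult T t \<one>\<^bsub>S\<^esub> = t"
      using t by (induction rule: tensor_induct) (simp_all add: simps N.rsmult_one)
    fix r assume r: "r \<in> carrier S"
    show "rsmult T t r \<in> carrier T" using t r by (simp add: rc)
    show "rsmult T (t \<oplus>\<^bsub>T\<^esub> t') r = rsmult T t r \<oplus>\<^bsub>T\<^esub> rsmult T t' r" if "t' \<in> carrier T" for t'
      using t r that by (simp add: ra)
    fix s assume s: "s \<in> carrier S"
    show "rsmult T t (r \<oplus>\<^bsub>S\<^esub> s) = rsmult T t r \<oplus>\<^bsub>T\<^esub> rsmult T t s"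
      using t r s
      by (induction rule: tensor_induct)
        (simp_all add: simps N.rsmult_add_right tensor_add_right)
    show "rsmult T t (r \<otimes>\<^bsub>S\<^esub> s) = rsmult T (rsmult T t r) s"
      using t r s
      by (induction rule: tensor_induct) (simp_all add: simps N.rsmult_assoc)
  qed
  moreover have "bimodule_axioms R S T"
  proof (unfold_locales)
    fix t assume t: "t \<in> carrier T"
    show "lsmult T \<one>\<^bsub>R\<^esub> t = t"
      using t by (induction rule: tensor_induct) (simp_all add: simps M.lsmult_one)
    fix r assume r: "r \<in> carrier R"
    show "lsmult T r t \<in> carrier T" using t r by (simp add: lc)
    show "lsmult T r (t \<oplus>\<^bsub>T\<^esub> t') = lsmult T r t \<oplus>\<^bsub>T\<^esub> lsmult T r t'" if "t' \<in> carrier T" for t'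
      using t r that by (simp add: la)
    show "rsmult T (lsmult T r t) s = lsmult T r (rsmult T t s)" if "s \<in> carrier S" for s
      using t r that by (induction rule: tensor_induct) (simp_all add: simps)
    fix r' assume r': "r' \<in> carrier R"
    show "lsmult T (r \<oplus>\<^bsub>R\<^esub> r') t = lsmult T r t \<oplus>\<^bsub>T\<^esub> lsmult T r' t"
      using t r r'
      by (induction rule: tensor_induct)
        (simp_all add: simps M.lsmult_add_left tensor_add_left)
    show "lsmult T (r \<otimes>\<^bsub>R\<^esub> r') t = lsmult T r (lsmult T r' t)"
      using t r r'
      by (induction rule: tensor_induct) (simp_all add: simps M.lsmult_assoc)
  qed
  ultimately show ?thesis
    by (intro bimodule.intro right_module.intro M.L.ring_axioms N.R.ring_axioms
        abelian_group_T)
qed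

text \<open>
  The universal property: a balanced biadditive map extends to the free abelian group and kills
  the relations, so it factors through the quotient.
\<close>

lemma tensor_lift:
  assumes G: "abelian_group G"
    and closed: "\<And>x y. \<lbrakk>x \<in> carrier M; y \<in> carrier N\<rbrakk> \<Longrightarrow> b x y \<in> carrier G"
    and add_left: "\<And>x x' y. \<lbrakk>x \<in> carrier M; x' \<in> carrier M; y \<in> carrier N\<rbrakk> \<Longrightarrow>
      b (x \<oplus>\<^bsub>M\<^esub> x') y = b x y \<oplus>\<^bsub>G\<^esub> b x' y"
    and add_right: "\<And>x y y'. \<lbrakk>x \<in> carrier M; y \<in> carrier N; y' \<in> carrier N\<rbrakk> \<Longrightarrow>
      b x (y \<oplus>\<^bsub>N\<^esub> y') = b x y \<oplus>\<^bsub>G\<^esub> b x y'"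
    and balanced: "\<And>x c y. \<lbrakk>x \<in> carrier M; c \<in> carrier B; y \<in> carrier N\<rbrakk> \<Longrightarrow>
      b (rsmult M x c) y = b x (lsmult N c y)"
  shows "abelian_group_hom T G (tensor_lift B M N G b)"
    and "\<lbrakk>x \<in> carrier M; y \<in> carrier N\<rbrakk> \<Longrightarrow>
      tensor_lift B M N G b (tensor B M N x y) = b x y"
proof -
  interpret G: abelian_group G by fact
  have "case_prod b ` (carrier M \<times> carrier N) \<subseteq> carrier (add_monoid G)"
    using closed by auto
  from comm_group.free_Abelian_group_universal[OF G.a_comm_group this]
  obtain f where f: "f \<in> hom free (add_monoid G)"
    and f_of: "\<And>p. p \<in> carrier M \<times> carrier N \<Longrightarrow> f (frag_of p) = case_prod b p"
    by blast
  interpret f: group_hom free "add_monoid G" f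
    using f by (intro group_hom.intro group_free_Abelian_group G.a_group group_hom_axioms.intro)
  have f_diff: "f (u - v) = f u \<ominus>\<^bsub>G\<^esub> f v" if "u \<in> carrier free" "v \<in> carrier free" for u v
    using that f.hom_mult[of u "- v"] f.hom_inv[OF that(2)]
    by (simp add: a_minus_def a_inv_def)
  have cancel: "p \<oplus>\<^bsub>G\<^esub> q \<ominus>\<^bsub>G\<^esub> p \<ominus>\<^bsub>G\<^esub> q = \<zero>\<^bsub>G\<^esub>" if "p \<in> carrier G" "q \<in> carrier G" for p q
  proof -
    have "p \<oplus>\<^bsub>G\<^esub> q \<ominus>\<^bsub>G\<^esub> p \<ominus>\<^bsub>G\<^esub> q = (p \<oplus>\<^bsub>G\<^esub> \<ominus>\<^bsub>G\<^esub> p) \<oplus>\<^bsub>G\<^esub> (q \<oplus>\<^bsub>G\<^esub> \<ominus>\<^bsub>G\<^esub> q)"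
      using that by (simp add: a_minus_def G.a_ac)
    then show ?thesis using that by (simp add: G.r_neg)
  qed
  have "p \<ominus>\<^bsub>G\<^esub> p = \<zero>\<^bsub>G\<^esub>" if "p \<in> carrier G" for p
    using that by (simp add: a_minus_def G.r_neg)
  with cancel have "f v = \<zero>\<^bsub>G\<^esub>" if "v \<in> tensor_relations B M N" for v
    using that unfolding tensor_relations_def
    by (auto simp: f_diff f_of free_diff_closed closed add_left add_right balanced
        M.rsmult_closed N.lsmult_closed
        simp del: carrier_free_Abelian_group_iff)
  then have "K \<subseteq> kernel free (add_monoid G) f"
    using tensor_relations_subset
    by (intro K_subset f.subgroup_kernel)
      (auto simp: kernel_def simp del: carrier_free_Abelian_group_iff)
  then obtain k where k: "k \<in> hom (free Mod K) (add_monoid G)"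
    and k_coset: "\<And>u. u \<in> carrier free \<Longrightarrow> k (coset u) = f u"
    using f.FactGroup_universal_kernel[OF normal_K] by blast
  have "abelian_group_hom T G k"
    using k by (intro abelian_group_hom_of_additive abelian_group_T G)
      (auto simp: tensor_bimodule_def Let_def hom_def)
  moreover have "k (tensor B M N x y) = b x y" if "x \<in> carrier M" "y \<in> carrier N" for x y
    using that by (simp add: tensor_def k_coset f_of)
  ultimately have "\<exists>k. abelian_group_hom T G k \<and>
      (\<forall>x\<in>carrier M. \<forall>y\<in>carrier N. k (tensor B M N x y) = b x y)"
    by blast
  from someI_ex[OF this]
  have lift: "abelian_group_hom T G (tensor_lift B M N G b) \<and>
      (\<forall>x\<in>carrier M. \<forall>y\<in>carrier N. tensor_lift B M N G b (tensor B M N x y) = b x y)"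
    unfolding tensor_lift_def .
  then show "abelian_group_hom T G (tensor_lift B M N G b)" ..
  show "tensor_lift B M N G b (tensor B M N x y) = b x y" if "x \<in> carrier M" "y \<in> carrier N"
    using lift that by blast
qed

end


section \<open>Dual bases of finitely generated projective modules\<close>

lemma (in abelian_monoid) finsum_swap:
  assumes "finite I" and "\<And>i j. \<lbrakk>i \<in> I; j \<in> J\<rbrakk> \<Longrightarrow> u i j \<in> carrier G"
  shows "(\<Oplus>i\<in>I. \<Oplus>j\<in>J. u i j) = (\<Oplus>j\<in>J. \<Oplus>i\<in>I. u i j)"
  using assms
proof (induction I rule: finite_induct)
  case empty
  then show ?case by (simp add: finsum_zero)
next
  case (insert k I)
  have "(\<Oplus>i\<in>insert k I. \<Oplus>j\<in>J. u i j) = (\<Oplus>j\<in>J. u k j) \<oplus> (\<Oplus>i\<in>I. \<Oplus>j\<in>J. u i j)"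
    using insert by (intro finsum_insert) (auto intro!: finsum_closed)
  also have "\<dots> = (\<Oplus>j\<in>J. u k j) \<oplus> (\<Oplus>j\<in>J. \<Oplus>i\<in>I. u i j)"
    using insert by simp
  also have "\<dots> = (\<Oplus>j\<in>J. u k j \<oplus> (\<Oplus>i\<in>I. u i j))"
    using insert by (intro finsum_addf[symmetric]) (auto intro!: finsum_closed)
  also have "\<dots> = (\<Oplus>j\<in>J. \<Oplus>i\<in>insert k I. u i j)"
    using insert by (intro finsum_cong' finsum_insert[symmetric]) (auto intro!: finsum_closed)
  finally show ?case .
qed

text \<open>
  Some modules below share their additive structure with a given ring or module but live in
  a different record.
\<close>

lemma abelian_group_same_addition:
  assumes "abelian_group G" and "carrier H = carrier G"
    and "ring.add H = ring.add G" and "ring.zero H = ring.zero G"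
  shows "abelian_group H"
proof -
  interpret G: abelian_group G by fact
  have "\<exists>y\<in>carrier G. y \<oplus>\<^bsub>G\<^esub> x = \<zero>\<^bsub>G\<^esub>" if "x \<in> carrier G" for x
    using that by (intro bexI[of _ "\<ominus>\<^bsub>G\<^esub> x"]) (simp_all add: G.l_neg)
  then show ?thesis
    by (intro abelian_groupI) (simp_all add: assms(2-4) G.a_ac)
qed

definition free_right_module ::
  "'i set \<Rightarrow> ('s, 'k) ring_scheme \<Rightarrow> ('s, 'i \<Rightarrow> 's) right_module" where
  "free_right_module I R =
    \<lparr>carrier = I \<rightarrow>\<^sub>E carrier R, monoid.mult = undefined, monoid.one = undefined,
     ring.zero = (\<lambda>i\<in>I. \<zero>\<^bsub>R\<^esub>), ring.add = (\<lambda>u v. \<lambda>i\<in>I. u i \<oplus>\<^bsub>R\<^esub> v i),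
     rsmult = (\<lambda>u r. \<lambda>i\<in>I. u i \<otimes>\<^bsub>R\<^esub> r)\<rparr>"

lemma free_right_module_simps:
  "carrier (free_right_module I R) = I \<rightarrow>\<^sub>E carrier R"
  "\<zero>\<^bsub>free_right_module I R\<^esub> = (\<lambda>i\<in>I. \<zero>\<^bsub>R\<^esub>)"
  "u \<oplus>\<^bsub>free_right_module I R\<^esub> v = (\<lambda>i\<in>I. u i \<oplus>\<^bsub>R\<^esub> v i)"
  "rsmult (free_right_module I R) u r = (\<lambda>i\<in>I. u i \<otimes>\<^bsub>R\<^esub> r)"
  by (simp_all add: free_right_module_def)

lemma (in ring) right_module_free: "right_module R (free_right_module I R)"
proof -
  have "abelian_group (free_right_module I R)"
  proof (rule abelian_groupI)
    fix u assume u: "u \<in> carrier (free_right_module I R)"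
    have "(\<lambda>i\<in>I. \<ominus> u i) \<in> carrier (free_right_module I R)"
      and "(\<lambda>i\<in>I. \<ominus> u i) \<oplus>\<^bsub>free_right_module I R\<^esub> u = \<zero>\<^bsub>free_right_module I R\<^esub>"
      using u by (auto simp: free_right_module_simps PiE_def Pi_def l_neg cong: restrict_cong)
    then show "\<exists>v\<in>carrier (free_right_module I R).
        v \<oplus>\<^bsub>free_right_module I R\<^esub> u = \<zero>\<^bsub>free_right_module I R\<^esub>" by blast
    show "\<zero>\<^bsub>free_right_module I R\<^esub> \<oplus>\<^bsub>free_right_module I R\<^esub> u = u"
      using u by (auto simp: free_right_module_simps PiE_def Pi_def extensional_def fun_eq_iff)
  qed (auto simp: free_right_module_simps PiE_def Pi_def a_ac cong: restrict_cong)
  then interpret F: abelian_group "free_right_module I R" .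
  show ?thesis
    by unfold_locales
      (auto simp: free_right_module_simps PiE_def Pi_def extensional_def fun_eq_iff
        l_distr r_distr m_assoc)
qed

lemma right_module_truncate:
  assumes "right_module R M"
  shows "right_module R (right_module.truncate M)"
proof -
  interpret right_module R M by fact
  have "abelian_group (right_module.truncate M)"
    by (rule abelian_group_same_addition[OF abelian_group_axioms])
      (simp_all add: right_module.defs)
  then interpret T: abelian_group "right_module.truncate M" .
  show ?thesis
    by unfold_locales
      (simp_all add: right_module.defs rsmult_closed rsmult_add_left rsmult_add_right
        rsmult_assoc rsmult_one)
qed

lemma right_module_homD:
  assumes "f \<in> right_module_hom R M N"
  shows "x \<in> carrier M \<Longrightarrow> f x \<in> carrier N"
    and "\<lbrakk>x \<in> carrier M; y \<in> carrier M\<rbrakk> \<Longrightarrow> f (x \<oplus>\<^bsub>M\<^esub> y) = f x \<oplus>\<^bsub>N\<^esub> f y"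
    and "\<lbrakk>x \<in> carrier M; r \<in> carrier R\<rbrakk> \<Longrightarrow> f (rsmult M x r) = rsmult N (f x) r"
  using assms by (auto simp: right_module_hom_def)

text \<open>
  Map the free module on a finite generating set \<open>I\<close> onto \<open>M\<close>. Projectivity splits this
  surjection, and the coordinates of the splitting are the dual functionals.
\<close>

lemma dual_basis:
  fixes R :: "('s, 'k) ring_scheme" and M :: "('s, 'm, 'e) right_module_scheme"
  assumes fg: "finitely_generated_right_module R M" and proj: "projective_right_module R M"
  obtains I \<phi> where "finite I" and "I \<subseteq> carrier M"
    and "\<And>i x. \<lbrakk>i \<in> I; x \<in> carrier M\<rbrakk> \<Longrightarrow> \<phi> i x \<in> carrier R"
    and "\<And>i x y. \<lbrakk>i \<in> I; x \<in> carrier M; y \<in> carrier M\<rbrakk> \<Longrightarrow>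
      \<phi> i (x \<oplus>\<^bsub>M\<^esub> y) = \<phi> i x \<oplus>\<^bsub>R\<^esub> \<phi> i y"
    and "\<And>i x r. \<lbrakk>i \<in> I; x \<in> carrier M; r \<in> carrier R\<rbrakk> \<Longrightarrow>
      \<phi> i (rsmult M x r) = \<phi> i x \<otimes>\<^bsub>R\<^esub> r"
    and "\<And>x. x \<in> carrier M \<Longrightarrow> (\<Oplus>\<^bsub>M\<^esub>i\<in>I. rsmult M i (\<phi> i x)) = x"
proof -
  interpret M: right_module R M using fg by (simp add: finitely_generated_right_module_def)
  obtain I where I: "finite I" "I \<subseteq> carrier M"
    and gen: "\<And>x. x \<in> carrier M \<Longrightarrow> \<exists>r\<in>I \<rightarrow> carrier R. x = (\<Oplus>\<^bsub>M\<^esub>i\<in>I. rsmult M i (r i))"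
    using fg unfolding finitely_generated_right_module_def by blast
  have I_carrier: "i \<in> carrier M" if "i \<in> I" for i using I(2) that by blast
  let ?V = "free_right_module I R"
  \<comment> \<open>Projectivity tests targets of the plain record type only, hence the truncation.\<close>
  let ?W = "right_module.truncate M"
  let ?p = "\<lambda>u. \<Oplus>\<^bsub>M\<^esub>i\<in>I. rsmult M i (u i)"
  have W: "carrier ?W = carrier M" "x \<oplus>\<^bsub>?W\<^esub> y = x \<oplus>\<^bsub>M\<^esub> y" "rsmult ?W x r = rsmult M x r" for x y r
    by (simp_all add: right_module.defs)
  have c: "(\<lambda>i. rsmult M i (u i)) \<in> I \<rightarrow> carrier M" if "u \<in> I \<rightarrow> carrier R" for u
    using that I_carrier by (simp add: Pi_def M.rsmult_closed)
  have p_closed: "?p u \<in> carrier M" if "u \<in> carrier ?V" for u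
    using that by (intro M.finsum_closed c) (simp add: free_right_module_simps PiE_def)
  have "?p \<in> right_module_hom R ?V ?W"
    unfolding right_module_hom_def
  proof (intro CollectI conjI ballI funcsetI)
    fix u assume u: "u \<in> carrier ?V"
    then have u': "u \<in> I \<rightarrow> carrier R" by (simp add: free_right_module_simps PiE_def)
    show "?p u \<in> carrier ?W" unfolding W using p_closed[OF u] .
    show "?p (rsmult ?V u r) = rsmult ?W (?p u) r" if r: "r \<in> carrier R" for r
      unfolding W abelian_group_hom.hom_finsum[OF M.rsmult_hom[OF r] c[OF u']]
      using u' r I_carrier
      by (intro M.finsum_cong')
        (simp_all add: free_right_module_simps M.rsmult_assoc M.rsmult_closed Pi_def)
    fix v assume v: "v \<in> carrier ?V"
    then have v': "v \<in> I \<rightarrow> carrier R" by (simp add: free_right_module_simps PiE_def)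
    show "?p (u \<oplus>\<^bsub>?V\<^esub> v) = ?p u \<oplus>\<^bsub>?W\<^esub> ?p v"
      unfolding W M.finsum_addf[OF c[OF u'] c[OF v'], symmetric]
      using u' v' I_carrier
      by (intro M.finsum_cong')
        (simp_all add: free_right_module_simps M.rsmult_add_right M.rsmult_closed Pi_def)
  qed
  moreover have "?p ` carrier ?V = carrier ?W"
  proof (intro equalityI subsetI)
    fix x assume "x \<in> carrier ?W"
    then obtain r where r: "r \<in> I \<rightarrow> carrier R" "x = (\<Oplus>\<^bsub>M\<^esub>i\<in>I. rsmult M i (r i))"
      using gen W by auto
    have eq: "x = ?p (restrict r I)"
      unfolding r(2) using r(1) I_carrier
      by (intro M.finsum_cong') (simp_all add: Pi_def M.rsmult_closed)
    have "restrict r I \<in> carrier ?V"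
      using r(1) by (simp add: free_right_module_simps)
    then show "x \<in> ?p ` carrier ?V"
      by (rule image_eqI[of x ?p "restrict r I", OF eq])
  qed (use p_closed W in auto)
  moreover have "id \<in> right_module_hom R M ?W"
    by (simp add: right_module_hom_def W)
  ultimately have "\<exists>q\<in>right_module_hom R M ?V. \<forall>x\<in>carrier M. ?p (q x) = id x"
    using proj M.R.right_module_free[of I] right_module_truncate[OF M.right_module_axioms]
    unfolding projective_right_module_def by blast
  then obtain q where q: "q \<in> right_module_hom R M ?V"
    and pq: "\<And>x. x \<in> carrier M \<Longrightarrow> ?p (q x) = x" by auto
  show thesis
  proof (rule that[of I "\<lambda>i x. q x i", OF I])
    show "q x i \<in> carrier R" if "i \<in> I" "x \<in> carrier M" for i x
      using right_module_homD(1)[OF q that(2)] that(1) by (auto simp: free_right_module_simps)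
  qed (use pq in \<open>simp_all add: right_module_homD(2,3)[OF q] free_right_module_simps\<close>)
qed


section \<open>Rings as bimodules\<close>

lemma ring_bimodule_simps:
  "carrier (ring_bimodule \<phi> \<psi> A) = carrier A"
  "x \<oplus>\<^bsub>ring_bimodule \<phi> \<psi> A\<^esub> y = x \<oplus>\<^bsub>A\<^esub> y"
  "\<zero>\<^bsub>ring_bimodule \<phi> \<psi> A\<^esub> = \<zero>\<^bsub>A\<^esub>"
  "rsmult (ring_bimodule \<phi> \<psi> A) x s = x \<otimes>\<^bsub>A\<^esub> \<psi> s"
  "lsmult (ring_bimodule \<phi> \<psi> A) r x = \<phi> r \<otimes>\<^bsub>A\<^esub> x"
  by (simp_all add: ring_bimodule_def)

lemma finsum_ring_bimodule: "finsum (ring_bimodule \<phi> \<psi> A) u I = finsum A u I"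
  by (simp add: finsum_def finprod_def ring_bimodule_def)

lemma (in ring) bimodule_ring_bimodule:
  assumes "ring U" "ring V" "\<phi> \<in> ring_hom U R" "\<psi> \<in> ring_hom V R"
  shows "bimodule U V (ring_bimodule \<phi> \<psi> R)"
proof -
  interpret U: ring U by fact
  interpret V: ring V by fact
  have "abelian_group (ring_bimodule \<phi> \<psi> R)"
    by (rule abelian_group_same_addition[OF abelian_group_axioms])
      (simp_all add: ring_bimodule_def)
  then interpret M: abelian_group "ring_bimodule \<phi> \<psi> R" .
  show ?thesis
    by unfold_locales
      (simp_all add: ring_bimodule_simps ring_hom_closed[OF assms(3)] ring_hom_closed[OF assms(4)]
        ring_hom_mult[OF assms(3)] ring_hom_mult[OF assms(4)]
        ring_hom_add[OF assms(3)] ring_hom_add[OF assms(4)]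
        ring_hom_one[OF assms(3)] ring_hom_one[OF assms(4)] l_distr r_distr m_assoc)
qed

text \<open>
  Bimodule homomorphisms out of a ring are determined by the image of \<open>\<one>\<close>. As \<open>\<one>\<close> commutes with
  the scalars that act through the structure map, so does its image, and every element with this
  property occurs.
\<close>

lemma (in bimodule) lsmult_central_hom:
  assumes "\<psi> \<in> ring_hom S R" and "m \<in> carrier M"
    and "\<And>s. s \<in> carrier S \<Longrightarrow> rsmult M m s = lsmult M (\<psi> s) m"
  shows "(\<lambda>r. lsmult M r m) \<in> bimodule_hom R S (ring_bimodule id \<psi> R) M"
proof -
  interpret A: bimodule R S "ring_bimodule id \<psi> R"
    by (intro L.bimodule_ring_bimodule L.ring_axioms R.ring_axioms assms(1))
      (simp add: ring_hom_def)
  show ?thesis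
    using assms(2)
    by (intro bimodule_homI A.abelian_group_axioms abelian_group_axioms)
      (simp_all add: ring_bimodule_simps lsmult_closed lsmult_add_left lsmult_assoc lsmult_rsmult
        assms(3) ring_hom_closed[OF assms(1)])
qed

lemma (in bimodule) rsmult_central_hom:
  assumes "\<phi> \<in> ring_hom R S" and "m \<in> carrier M"
    and "\<And>r. r \<in> carrier R \<Longrightarrow> lsmult M r m = rsmult M m (\<phi> r)"
  shows "(\<lambda>s. rsmult M m s) \<in> bimodule_hom R S (ring_bimodule \<phi> id S) M"
proof -
  interpret A: bimodule R S "ring_bimodule \<phi> id S"
    by (intro R.bimodule_ring_bimodule L.ring_axioms R.ring_axioms assms(1))
      (simp add: ring_hom_def)
  show ?thesis
    using assms(2)
    by (intro bimodule_homI A.abelian_group_axioms abelian_group_axioms)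
      (simp_all add: ring_bimodule_simps rsmult_closed rsmult_add_right rsmult_assoc
        assms(3)[symmetric] lsmult_rsmult[symmetric] ring_hom_closed[OF assms(1)])
qed

lemma (in bimodule) hom_from_left_ring:
  assumes "\<psi> \<in> ring_hom S R" and f: "f \<in> bimodule_hom R S (ring_bimodule id \<psi> R) M"
  shows "f \<one>\<^bsub>R\<^esub> \<in> carrier M"
    and "r \<in> carrier R \<Longrightarrow> f r = lsmult M r (f \<one>\<^bsub>R\<^esub>)"
    and "s \<in> carrier S \<Longrightarrow> rsmult M (f \<one>\<^bsub>R\<^esub>) s = lsmult M (\<psi> s) (f \<one>\<^bsub>R\<^esub>)"
proof -
  show "f \<one>\<^bsub>R\<^esub> \<in> carrier M"
    using bimodule_homD(2)[OF f, of "\<one>\<^bsub>R\<^esub>"] by (simp add: ring_bimodule_simps)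
  show lin: "f r = lsmult M r (f \<one>\<^bsub>R\<^esub>)" if "r \<in> carrier R" for r
    using bimodule_homD(4)[OF f that, of "\<one>\<^bsub>R\<^esub>"] that by (simp add: ring_bimodule_simps)
  show "rsmult M (f \<one>\<^bsub>R\<^esub>) s = lsmult M (\<psi> s) (f \<one>\<^bsub>R\<^esub>)" if "s \<in> carrier S"
    using bimodule_homD(5)[OF f _ that, of "\<one>\<^bsub>R\<^esub>"] lin[of "\<psi> s"] ring_hom_closed[OF assms(1) that]
    by (simp add: ring_bimodule_simps)
qed

lemma (in bimodule) hom_from_right_ring:
  assumes "\<phi> \<in> ring_hom R S" and f: "f \<in> bimodule_hom R S (ring_bimodule \<phi> id S) M"
  shows "f \<one>\<^bsub>S\<^esub> \<in> carrier M"
    and "s \<in> carrier S \<Longrightarrow> f s = rsmult M (f \<one>\<^bsub>S\<^esub>) s"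
    and "r \<in> carrier R \<Longrightarrow> lsmult M r (f \<one>\<^bsub>S\<^esub>) = rsmult M (f \<one>\<^bsub>S\<^esub>) (\<phi> r)"
proof -
  show "f \<one>\<^bsub>S\<^esub> \<in> carrier M"
    using bimodule_homD(2)[OF f, of "\<one>\<^bsub>S\<^esub>"] by (simp add: ring_bimodule_simps)
  show lin: "f s = rsmult M (f \<one>\<^bsub>S\<^esub>) s" if "s \<in> carrier S" for s
    using bimodule_homD(5)[OF f _ that, of "\<one>\<^bsub>S\<^esub>"] that by (simp add: ring_bimodule_simps)
  show "lsmult M r (f \<one>\<^bsub>S\<^esub>) = rsmult M (f \<one>\<^bsub>S\<^esub>) (\<phi> r)" if "r \<in> carrier R"
    using bimodule_homD(4)[OF f that, of "\<one>\<^bsub>S\<^esub>"] lin[of "\<phi> r"] ring_hom_closed[OF assms(1) that]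
    by (simp add: ring_bimodule_simps)
qed


section \<open>Endomorphisms and tensors over a tower\<close>

context ring_tower
begin

abbreviation "gh \<equiv> g \<circ> h"
abbreviation "A_ring_C \<equiv> ring_bimodule id gh A"
abbreviation "C_ring_A \<equiv> ring_bimodule gh id A"
abbreviation "E \<equiv> End_bimodule A B g h"

lemma hom_C_A: "gh \<in> ring_hom C A"
  by (rule ring_hom_trans[OF hom_C_B hom_B_A])

lemma id_hom: "id \<in> ring_hom A A"
  by (simp add: ring_hom_def)

lemma g_closed: "b \<in> carrier B \<Longrightarrow> g b \<in> carrier A"
  by (rule ring_hom_closed[OF hom_B_A])

lemma gh_closed: "c \<in> carrier C \<Longrightarrow> g (h c) \<in> carrier A"
  using ring_hom_closed[OF hom_C_A] by simp

sublocale pair: bimodule_pair C B A "ring_bimodule gh g A" "ring_bimodule g id A"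
  by (intro bimodule_pair.intro A.bimodule_ring_bimodule A.ring_axioms B.ring_axioms
      C.ring_axioms hom_C_A hom_B_A id_hom)

text \<open>
  \<open>A \<otimes>\<^sub>B A\<close> and its pure tensors are made constants of their own, so that rewriting does not
  enter the structure maps inside them.
\<close>

definition AA :: "('a, ('a \<times> 'a \<Rightarrow>\<^sub>0 int) set, 'c) bimodule" where
  "AA = tensor_bimodule B (ring_bimodule gh g A) (ring_bimodule g id A)"

definition tens :: "'a \<Rightarrow> 'a \<Rightarrow> ('a \<times> 'a \<Rightarrow>\<^sub>0 int) set" where
  "tens x y = tensor B (ring_bimodule gh g A) (ring_bimodule g id A) x y"

lemma bimodule_AA: "bimodule C A AA"
  unfolding AA_def by (rule pair.bimodule_T)

sublocale AA: bimodule C A AA by (rule bimodule_AA)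

lemma bimodule_A_C: "bimodule A C A_ring_C"
  by (intro A.bimodule_ring_bimodule A.ring_axioms C.ring_axioms hom_C_A id_hom)

lemma bimodule_C_A: "bimodule C A C_ring_A"
  by (intro A.bimodule_ring_bimodule A.ring_axioms C.ring_axioms hom_C_A id_hom)

lemmas tens_closed = pair.tensor_closed[unfolded ring_bimodule_simps, folded AA_def tens_def]
  and tens_add_left = pair.tensor_add_left[unfolded ring_bimodule_simps, folded AA_def tens_def]
  and tens_add_right = pair.tensor_add_right[unfolded ring_bimodule_simps, folded AA_def tens_def]
  and tens_balanced = pair.tensor_balanced[unfolded ring_bimodule_simps, folded tens_def]

lemma tens_lsmult:
  "\<lbrakk>c \<in> carrier C; x \<in> carrier A; y \<in> carrier A\<rbrakk> \<Longrightarrow>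
    lsmult AA c (tens x y) = tens (g (h c) \<otimes>\<^bsub>A\<^esub> x) y"
  using pair.lsmult_tensor[of c x y] by (simp add: ring_bimodule_simps AA_def tens_def)

lemma tens_rsmult:
  "\<lbrakk>a \<in> carrier A; x \<in> carrier A; y \<in> carrier A\<rbrakk> \<Longrightarrow>
    rsmult AA (tens x y) a = tens x (y \<otimes>\<^bsub>A\<^esub> a)"
  using pair.rsmult_tensor[of a x y] by (simp add: ring_bimodule_simps AA_def tens_def)

lemmas tens_induct [consumes 1, case_names tensor add] =
  pair.tensor_induct[unfolded ring_bimodule_simps, folded AA_def tens_def]

lemma E_iff:
  "f \<in> carrier E \<longleftrightarrow> f \<in> carrier A \<rightarrow> carrier A \<and> f \<in> extensional (carrier A) \<and>
    (\<forall>x\<in>carrier A. \<forall>y\<in>carrier A. f (x \<oplus>\<^bsub>A\<^esub> y) = f x \<oplus>\<^bsub>A\<^esub> f y) \<and>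
    (\<forall>x\<in>carrier A. \<forall>b\<in>carrier B. f (x \<otimes>\<^bsub>A\<^esub> g b) = f x \<otimes>\<^bsub>A\<^esub> g b)"
  by (auto simp: End_bimodule_def right_module_hom_def ring_bimodule_simps)

lemma E_D:
  assumes "f \<in> carrier E"
  shows "x \<in> carrier A \<Longrightarrow> f x \<in> carrier A"
    and "\<lbrakk>x \<in> carrier A; y \<in> carrier A\<rbrakk> \<Longrightarrow> f (x \<oplus>\<^bsub>A\<^esub> y) = f x \<oplus>\<^bsub>A\<^esub> f y"
    and "\<lbrakk>x \<in> carrier A; b \<in> carrier B\<rbrakk> \<Longrightarrow> f (x \<otimes>\<^bsub>A\<^esub> g b) = f x \<otimes>\<^bsub>A\<^esub> g b"
  using assms by (auto simp: E_iff)

lemma E_eqI: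
  assumes "f \<in> carrier E" "f' \<in> carrier E" "\<And>x. x \<in> carrier A \<Longrightarrow> f x = f' x"
  shows "f = f'"
  using assms by (intro extensionalityI[of f "carrier A" f']) (simp_all add: E_iff)

lemma E_simps:
  "\<zero>\<^bsub>E\<^esub> = (\<lambda>x\<in>carrier A. \<zero>\<^bsub>A\<^esub>)"
  "f \<oplus>\<^bsub>E\<^esub> f' = (\<lambda>x\<in>carrier A. f x \<oplus>\<^bsub>A\<^esub> f' x)"
  "rsmult E f c = (\<lambda>x\<in>carrier A. f (g (h c) \<otimes>\<^bsub>A\<^esub> x))"
  "lsmult E a f = (\<lambda>x\<in>carrier A. a \<otimes>\<^bsub>A\<^esub> f x)"
  by (simp_all add: End_bimodule_def)

lemma E_closed:
  "\<zero>\<^bsub>E\<^esub> \<in> carrier E"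
  "\<lbrakk>f \<in> carrier E; f' \<in> carrier E\<rbrakk> \<Longrightarrow> f \<oplus>\<^bsub>E\<^esub> f' \<in> carrier E"
  "\<lbrakk>f \<in> carrier E; c \<in> carrier C\<rbrakk> \<Longrightarrow> rsmult E f c \<in> carrier E"
  "\<lbrakk>a \<in> carrier A; f \<in> carrier E\<rbrakk> \<Longrightarrow> lsmult E a f \<in> carrier E"
  unfolding E_simps
  by (simp_all add: E_iff[of "restrict _ _"] E_D g_closed gh_closed A.l_distr A.r_distr
      A.a_ac A.m_assoc[symmetric])

lemma abelian_group_E: "abelian_group E"
proof (rule abelian_groupI)
  fix f assume f: "f \<in> carrier E"
  let ?m = "\<lambda>x\<in>carrier A. \<ominus>\<^bsub>A\<^esub> f x"
  have "?m \<in> carrier E"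
    unfolding E_iff using f
    by (simp add: E_D g_closed A.minus_add A.l_minus)
  moreover have "?m \<oplus>\<^bsub>E\<^esub> f = \<zero>\<^bsub>E\<^esub>"
    using f by (simp add: E_simps E_D A.l_neg cong: restrict_cong)
  ultimately show "\<exists>f'\<in>carrier E. f' \<oplus>\<^bsub>E\<^esub> f = \<zero>\<^bsub>E\<^esub>" by blast
  show "\<zero>\<^bsub>E\<^esub> \<oplus>\<^bsub>E\<^esub> f = f"
    using f by (intro E_eqI E_closed) (simp_all add: E_simps E_D)
  fix f' assume f': "f' \<in> carrier E"
  show "f \<oplus>\<^bsub>E\<^esub> f' = f' \<oplus>\<^bsub>E\<^esub> f"
    using f f' by (intro E_eqI E_closed) (simp_all add: E_simps E_D A.a_comm)
  fix f'' assume f'': "f'' \<in> carrier E"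
  show "f \<oplus>\<^bsub>E\<^esub> f' \<oplus>\<^bsub>E\<^esub> f'' = f \<oplus>\<^bsub>E\<^esub> (f' \<oplus>\<^bsub>E\<^esub> f'')"
    using f f' f'' by (intro E_eqI E_closed) (simp_all add: E_simps E_D A.a_assoc)
qed (simp_all add: E_closed)

lemma bimodule_E: "bimodule A C E"
proof -
  have restrict: "restrict f (carrier A) = f" if "f \<in> carrier E" for f
    using that by (simp add: E_iff extensional_restrict)
  have "right_module_axioms C E"
    by unfold_locales
      (simp_all add: E_closed[unfolded E_simps] E_simps E_D gh_closed restrict A.m_assoc A.l_distr
        ring_hom_add[OF hom_C_B] ring_hom_add[OF hom_B_A] ring_hom_mult[OF hom_C_B]
        ring_hom_mult[OF hom_B_A] ring_hom_one[OF hom_C_B] ring_hom_one[OF hom_B_A]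
        ring_hom_closed[OF hom_C_B] cong: restrict_cong)
  moreover have "bimodule_axioms A C E"
    by unfold_locales
      (simp_all add: E_closed[unfolded E_simps] E_simps E_D gh_closed restrict A.m_assoc
        A.l_distr A.r_distr        cong: restrict_cong)
  ultimately show ?thesis
    by (intro bimodule.intro right_module.intro A.ring_axioms C.ring_axioms abelian_group_E)
qed

sublocale E: bimodule A C E by (rule bimodule_E)

text \<open>The right \<open>A\<close>-linear extension of \<open>f\<close> along \<open>x \<mapsto> x \<otimes> 1\<close>.\<close>

definition ev :: "('a \<Rightarrow> 'a) \<Rightarrow> ('a \<times> 'a \<Rightarrow>\<^sub>0 int) set \<Rightarrow> 'a" where
  "ev f = tensor_lift B (ring_bimodule gh g A) (ring_bimodule g id A) A (\<lambda>x y. f x \<otimes>\<^bsub>A\<^esub> y)"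

lemma
  assumes f: "f \<in> carrier E"
  shows ev_hom: "abelian_group_hom AA A (ev f)"
    and ev_tens: "\<lbrakk>x \<in> carrier A; y \<in> carrier A\<rbrakk> \<Longrightarrow> ev f (tens x y) = f x \<otimes>\<^bsub>A\<^esub> y"
  unfolding ev_def
  by (rule pair.tensor_lift[unfolded ring_bimodule_simps, folded AA_def tens_def];
      simp add: f E_D g_closed A.abelian_group_axioms A.l_distr A.r_distr A.m_assoc)+

lemma ev_closed: "\<lbrakk>f \<in> carrier E; t \<in> carrier AA\<rbrakk> \<Longrightarrow> ev f t \<in> carrier A"
  by (rule abelian_group_hom.hom_closed[OF ev_hom])

lemma ev_add: "\<lbrakk>f \<in> carrier E; s \<in> carrier AA; t \<in> carrier AA\<rbrakk> \<Longrightarrow>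
    ev f (s \<oplus>\<^bsub>AA\<^esub> t) = ev f s \<oplus>\<^bsub>A\<^esub> ev f t"
  by (rule abelian_group_hom.hom_add[OF ev_hom])

lemma ev_rsmult:
  assumes f: "f \<in> carrier E" and "t \<in> carrier AA" and a: "a \<in> carrier A"
  shows "ev f (rsmult AA t a) = ev f t \<otimes>\<^bsub>A\<^esub> a"
  using assms(2)
proof (induction rule: tens_induct)
  case (tensor x y)
  then show ?case using f a by (simp add: tens_rsmult ev_tens E_D[OF f] A.m_assoc)
next
  case (add s t)
  then show ?case using f a
    by (simp add: AA.rsmult_add_left AA.rsmult_closed ev_add ev_closed A.l_distr)
qed

lemma ev_add_endo:
  assumes f: "f \<in> carrier E" "f' \<in> carrier E" and "t \<in> carrier AA"
  shows "ev (f \<oplus>\<^bsub>E\<^esub> f') t = ev f t \<oplus>\<^bsub>A\<^esub> ev f' t"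
  using assms(3)
proof (induction rule: tens_induct)
  case (tensor x y)
  then show ?case using f by (simp add: ev_tens E_closed) (simp add: E_simps E_D[OF f(1)] E_D[OF f(2)] A.l_distr)
next
  case (add s t)
  then show ?case using f by (simp add: E_closed ev_add ev_closed A.a_ac)
qed

lemma ev_lsmult_endo:
  assumes f: "f \<in> carrier E" and a: "a \<in> carrier A" and "t \<in> carrier AA"
  shows "ev (lsmult E a f) t = a \<otimes>\<^bsub>A\<^esub> ev f t"
  using assms(3)
proof (induction rule: tens_induct)
  case (tensor x y)
  then show ?case using f a by (simp add: ev_tens E_closed) (simp add: E_simps E_D[OF f] A.m_assoc)
next
  case (add s t)
  then show ?case using f a by (simp add: E_closed ev_add ev_closed A.r_distr)
qed

text \<open>
  The right action of \<open>C\<close> on \<open>E\<close> precomposes with left multiplication on the first tensor factor.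
  This is what makes evaluation at a tensor commuting with \<open>C\<close> right \<open>C\<close>-linear.
\<close>

lemma ev_rsmult_endo:
  assumes f: "f \<in> carrier E" and c: "c \<in> carrier C" and "t \<in> carrier AA"
  shows "ev (rsmult E f c) t = ev f (lsmult AA c t)"
  using assms(3)
proof (induction rule: tens_induct)
  case (tensor x y)
  then show ?case using f c
    by (simp add: ev_tens E_closed tens_lsmult gh_closed) (simp add: E_simps)
next
  case (add s t)
  then show ?case using f c
    by (simp add: E_closed ev_add AA.lsmult_add_right AA.lsmult_closed)
qed

text \<open>
  The two sets of elements commuting with \<open>C\<close>; the condition on \<open>f\<close> says that \<open>f\<close> is left
  \<open>C\<close>-linear.
\<close>

definition central_endos :: "('a \<Rightarrow> 'a) set" where
  "central_endos =
    {f \<in> carrier E. \<forall>c\<in>carrier C. rsmult E f c = lsmult E (g (h c)) f}"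

definition central_tensors :: "('a \<times> 'a \<Rightarrow>\<^sub>0 int) set set" where
  "central_tensors =
    {t \<in> carrier AA. \<forall>c\<in>carrier C. lsmult AA c t = rsmult AA t (g (h c))}"

text \<open>
  By right \<open>A\<close>-linearity a bimodule map \<open>A \<otimes>\<^sub>B A \<rightarrow> A\<close> is determined by its values
  \<open>\<beta>(x)\<close> at \<open>x \<otimes> 1\<close>, and the factorization of the identity has to be tested at these tensors only.
\<close>

lemma left_depth_three_iff:
  "left_depth_three A B C g h \<longleftrightarrow>
    (\<exists>N>0::nat. \<exists>\<beta> t. (\<forall>i<N. \<beta> i \<in> central_endos \<and> t i \<in> central_tensors) \<and>
      (\<forall>x\<in>carrier A. (\<Oplus>\<^bsub>AA\<^esub>i\<in>{..<N}. rsmult AA (t i) (\<beta> i x)) = tens x \<one>\<^bsub>A\<^esub>))"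
proof -
  interpret CA: bimodule C A C_ring_A by (rule bimodule_C_A)
  have "iso_to_direct_summand C A AA (power_bimodule N C_ring_A) \<longleftrightarrow>
      (\<exists>\<beta> t. (\<forall>i<N. \<beta> i \<in> central_endos \<and> t i \<in> central_tensors) \<and>
        (\<forall>x\<in>carrier A. (\<Oplus>\<^bsub>AA\<^esub>i\<in>{..<N}. rsmult AA (t i) (\<beta> i x)) = tens x \<one>\<^bsub>A\<^esub>))"
    (is "_ \<longleftrightarrow> ?quasibase") for N
    unfolding CA.iso_to_direct_summand_power_iff[OF bimodule_AA]
  proof
    assume "\<exists>\<iota> \<pi>. (\<forall>i<N. \<iota> i \<in> bimodule_hom C A AA C_ring_A \<and>
        \<pi> i \<in> bimodule_hom C A C_ring_A AA) \<and>
        (\<forall>x\<in>carrier AA. (\<Oplus>\<^bsub>AA\<^esub>i\<in>{..<N}. \<pi> i (\<iota> i x)) = x)"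
    then obtain \<iota> \<pi>
      where hom: "\<forall>i<N. \<iota> i \<in> bimodule_hom C A AA C_ring_A \<and> \<pi> i \<in> bimodule_hom C A C_ring_A AA"
        and retract: "\<forall>s\<in>carrier AA. (\<Oplus>\<^bsub>AA\<^esub>i\<in>{..<N}. \<pi> i (\<iota> i s)) = s"
      by (elim exE conjE) (rule that)
    have \<iota>: "\<iota> i \<in> bimodule_hom C A AA C_ring_A" and \<pi>: "\<pi> i \<in> bimodule_hom C A C_ring_A AA"
      if "i < N" for i
      using hom that by simp_all
    have \<pi>\<iota>: "(\<Oplus>\<^bsub>AA\<^esub>i\<in>{..<N}. \<pi> i (\<iota> i s)) = s" if "s \<in> carrier AA" for s
      using retract that by (rule bspec)
    define \<beta> where "\<beta> i = (\<lambda>x\<in>carrier A. \<iota> i (tens x \<one>\<^bsub>A\<^esub>))" for i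
    note \<iota>D = bimodule_homD(2-5)[OF \<iota>, unfolded ring_bimodule_simps]
    show ?quasibase
    proof (intro exI conjI allI impI ballI)
      fix i assume i: "i < N"
      have "\<iota> i (tens (x \<otimes>\<^bsub>A\<^esub> g b) \<one>\<^bsub>A\<^esub>) = \<iota> i (tens x \<one>\<^bsub>A\<^esub>) \<otimes>\<^bsub>A\<^esub> g b"
        if "x \<in> carrier A" "b \<in> carrier B" for x b
      proof -
        have "tens (x \<otimes>\<^bsub>A\<^esub> g b) \<one>\<^bsub>A\<^esub> = rsmult AA (tens x \<one>\<^bsub>A\<^esub>) (g b)"
          using that by (simp add: tens_balanced tens_rsmult g_closed)
        then show ?thesis using \<iota>D(4)[OF i] that by (simp add: tens_closed g_closed)
      qed
      then have E: "\<beta> i \<in> carrier E"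
        unfolding E_iff \<beta>_def using \<iota>D(1,2)[OF i]
        by (simp add: tens_closed tens_add_left g_closed)
      moreover have "rsmult E (\<beta> i) c = lsmult E (g (h c)) (\<beta> i)" if c: "c \<in> carrier C" for c
      proof (rule E_eqI)
        fix x assume x: "x \<in> carrier A"
        have "tens (g (h c) \<otimes>\<^bsub>A\<^esub> x) \<one>\<^bsub>A\<^esub> = lsmult AA c (tens x \<one>\<^bsub>A\<^esub>)"
          using x c by (simp add: tens_lsmult)
        then show "rsmult E (\<beta> i) c x = lsmult E (g (h c)) (\<beta> i) x"
          using x c \<iota>D(3)[OF i] by (simp add: E_simps \<beta>_def gh_closed tens_closed)
      qed (use E c in \<open>simp_all add: E_closed gh_closed\<close>)
      ultimately show "\<beta> i \<in> central_endos" by (simp add: central_endos_def)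
      show "\<pi> i \<one>\<^bsub>A\<^esub> \<in> central_tensors"
        using AA.hom_from_right_ring(1,3)[OF hom_C_A \<pi>[OF i]]
        by (simp add: central_tensors_def)
    next
      fix x assume x: "x \<in> carrier A"
      have "(\<Oplus>\<^bsub>AA\<^esub>i\<in>{..<N}. rsmult AA (\<pi> i \<one>\<^bsub>A\<^esub>) (\<beta> i x)) =
          (\<Oplus>\<^bsub>AA\<^esub>i\<in>{..<N}. \<pi> i (\<iota> i (tens x \<one>\<^bsub>A\<^esub>)))"
        using x \<iota>D(1) bimodule_homD(2)[OF \<pi>, unfolded ring_bimodule_simps]
        by (intro AA.finsum_cong')
          (simp_all add: \<beta>_def tens_closed Pi_def
            AA.hom_from_right_ring(2)[OF hom_C_A \<pi>, symmetric])
      also have "\<dots> = tens x \<one>\<^bsub>A\<^esub>"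
        using x by (simp add: \<pi>\<iota> tens_closed)
      finally show "(\<Oplus>\<^bsub>AA\<^esub>i\<in>{..<N}. rsmult AA (\<pi> i \<one>\<^bsub>A\<^esub>) (\<beta> i x)) = tens x \<one>\<^bsub>A\<^esub>" .
    qed
  next
    assume ?quasibase
    then obtain \<beta> t
      where central: "\<forall>i<N. \<beta> i \<in> central_endos \<and> t i \<in> central_tensors"
        and quasibase: "\<forall>x\<in>carrier A.
          (\<Oplus>\<^bsub>AA\<^esub>i\<in>{..<N}. rsmult AA (t i) (\<beta> i x)) = tens x \<one>\<^bsub>A\<^esub>"
      by (elim exE conjE) (rule that)
    have \<beta>: "\<beta> i \<in> central_endos" and t: "t i \<in> central_tensors" if "i < N" for i
      using central that by simp_all
    have eq: "(\<Oplus>\<^bsub>AA\<^esub>i\<in>{..<N}. rsmult AA (t i) (\<beta> i x)) = tens x \<one>\<^bsub>A\<^esub>"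
      if "x \<in> carrier A" for x
      using quasibase that by (rule bspec)
    have \<beta>E: "\<beta> i \<in> carrier E" and tA: "t i \<in> carrier AA" if "i < N" for i
      using \<beta>[OF that] t[OF that] by (simp_all add: central_endos_def central_tensors_def)
    show "\<exists>\<iota> \<pi>. (\<forall>i<N. \<iota> i \<in> bimodule_hom C A AA C_ring_A \<and>
        \<pi> i \<in> bimodule_hom C A C_ring_A AA) \<and>
        (\<forall>x\<in>carrier AA. (\<Oplus>\<^bsub>AA\<^esub>i\<in>{..<N}. \<pi> i (\<iota> i x)) = x)"
    proof (intro exI conjI allI impI ballI)
      fix i assume i: "i < N"
      have "ev (\<beta> i) (lsmult AA c s) = g (h c) \<otimes>\<^bsub>A\<^esub> ev (\<beta> i) s"
        if "c \<in> carrier C" "s \<in> carrier AA" for c s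
      proof -
        have "rsmult E (\<beta> i) c = lsmult E (g (h c)) (\<beta> i)"
          using \<beta>[OF i] that by (simp add: central_endos_def)
        then show ?thesis
          using ev_rsmult_endo[OF \<beta>E[OF i] that] that
          by (simp add: ev_lsmult_endo \<beta>E[OF i] gh_closed)
      qed
      then show "ev (\<beta> i) \<in> bimodule_hom C A AA C_ring_A"
        using \<beta>E[OF i]
        by (intro bimodule_homI AA.abelian_group_axioms CA.abelian_group_axioms)
          (simp_all add: ring_bimodule_simps ev_closed ev_add ev_rsmult)
      show "(\<lambda>a. rsmult AA (t i) a) \<in> bimodule_hom C A C_ring_A AA"
        using t[OF i] by (intro AA.rsmult_central_hom hom_C_A) (simp_all add: central_tensors_def)
    next
      fix s assume "s \<in> carrier AA"
      have c: "(\<lambda>i. rsmult AA (t i) (ev (\<beta> i) s)) \<in> {..<N} \<rightarrow> carrier AA" if "s \<in> carrier AA" for s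
        using that \<beta>E tA by (simp add: Pi_def AA.rsmult_closed ev_closed)
      from \<open>s \<in> carrier AA\<close>
      show "(\<Oplus>\<^bsub>AA\<^esub>i\<in>{..<N}. rsmult AA (t i) (ev (\<beta> i) s)) = s"
      proof (induction rule: tens_induct)
        case (tensor x y)
        have "(\<Oplus>\<^bsub>AA\<^esub>i\<in>{..<N}. rsmult AA (t i) (ev (\<beta> i) (tens x y))) =
            (\<Oplus>\<^bsub>AA\<^esub>i\<in>{..<N}. rsmult AA (rsmult AA (t i) (\<beta> i x)) y)"
          using tensor \<beta>E tA
          by (intro AA.finsum_cong')
            (simp_all add: Pi_def ev_tens E_D[OF \<beta>E] AA.rsmult_closed AA.rsmult_assoc)
        also have "\<dots> = rsmult AA (\<Oplus>\<^bsub>AA\<^esub>i\<in>{..<N}. rsmult AA (t i) (\<beta> i x)) y"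
          using tensor \<beta>E tA
          by (intro abelian_group_hom.hom_finsum[OF AA.rsmult_hom, symmetric])
            (simp_all add: Pi_def E_D[OF \<beta>E] AA.rsmult_closed)
        also have "\<dots> = tens x y"
          using tensor by (simp add: eq tens_rsmult)
        finally show ?case .
      next
        case (add s s')
        have "(\<Oplus>\<^bsub>AA\<^esub>i\<in>{..<N}. rsmult AA (t i) (ev (\<beta> i) (s \<oplus>\<^bsub>AA\<^esub> s'))) =
            (\<Oplus>\<^bsub>AA\<^esub>i\<in>{..<N}. rsmult AA (t i) (ev (\<beta> i) s) \<oplus>\<^bsub>AA\<^esub>
              rsmult AA (t i) (ev (\<beta> i) s'))"
          using add(1,2) \<beta>E tA
          by (intro AA.finsum_cong')
            (simp_all add: Pi_def ev_add ev_closed AA.rsmult_closed AA.rsmult_add_right)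
        also have "\<dots> = s \<oplus>\<^bsub>AA\<^esub> s'"
          unfolding AA.finsum_addf[OF c[OF add(1)] c[OF add(2)]] add(3,4) ..
        finally show ?case .
      qed
    qed
  qed
  then show ?thesis
    unfolding left_depth_three_def AA_def[symmetric] by (simp only:)
qed

lemma End_direct_summand_iff:
  "iso_to_direct_summand A C E (power_bimodule N A_ring_C) \<longleftrightarrow>
    (\<exists>\<beta> \<tau>. (\<forall>i<N. \<beta> i \<in> central_endos \<and> \<tau> i \<in> bimodule_hom A C E A_ring_C) \<and>
      (\<forall>f\<in>carrier E. (\<Oplus>\<^bsub>E\<^esub>i\<in>{..<N}. lsmult E (\<tau> i f) (\<beta> i)) = f))"
    (is "_ \<longleftrightarrow> ?quasibase")
proof -
  interpret AC: bimodule A C A_ring_C by (rule bimodule_A_C)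
  show ?thesis
    unfolding AC.iso_to_direct_summand_power_iff[OF bimodule_E]
  proof
    assume "\<exists>\<iota> \<pi>. (\<forall>i<N. \<iota> i \<in> bimodule_hom A C E A_ring_C \<and>
        \<pi> i \<in> bimodule_hom A C A_ring_C E) \<and>
        (\<forall>f\<in>carrier E. (\<Oplus>\<^bsub>E\<^esub>i\<in>{..<N}. \<pi> i (\<iota> i f)) = f)"
    then obtain \<iota> \<pi>
      where hom: "\<forall>i<N. \<iota> i \<in> bimodule_hom A C E A_ring_C \<and> \<pi> i \<in> bimodule_hom A C A_ring_C E"
        and retract: "\<forall>f\<in>carrier E. (\<Oplus>\<^bsub>E\<^esub>i\<in>{..<N}. \<pi> i (\<iota> i f)) = f"
      by (elim exE conjE) (rule that)
    have \<iota>: "\<iota> i \<in> bimodule_hom A C E A_ring_C" and \<pi>: "\<pi> i \<in> bimodule_hom A C A_ring_C E"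
      if "i < N" for i
      using hom that by simp_all
    have \<pi>\<iota>: "(\<Oplus>\<^bsub>E\<^esub>i\<in>{..<N}. \<pi> i (\<iota> i f)) = f" if "f \<in> carrier E" for f
      using retract that by (rule bspec)
    show ?quasibase
    proof (intro exI conjI allI impI ballI)
      fix i assume i: "i < N"
      show "\<pi> i \<one>\<^bsub>A\<^esub> \<in> central_endos"
        using E.hom_from_left_ring(1,3)[OF hom_C_A \<pi>[OF i]] by (simp add: central_endos_def)
      show "\<iota> i \<in> bimodule_hom A C E A_ring_C" by (rule \<iota>[OF i])
    next
      fix f assume f: "f \<in> carrier E"
      have "(\<Oplus>\<^bsub>E\<^esub>i\<in>{..<N}. lsmult E (\<iota> i f) (\<pi> i \<one>\<^bsub>A\<^esub>)) = (\<Oplus>\<^bsub>E\<^esub>i\<in>{..<N}. \<pi> i (\<iota> i f))"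
        using f bimodule_homD(2)[OF \<iota>, unfolded ring_bimodule_simps]
          bimodule_homD(2)[OF \<pi>, unfolded ring_bimodule_simps]
        by (intro E.finsum_cong')
          (simp_all add: Pi_def E.hom_from_left_ring(2)[OF hom_C_A \<pi>, symmetric])
      then show "(\<Oplus>\<^bsub>E\<^esub>i\<in>{..<N}. lsmult E (\<iota> i f) (\<pi> i \<one>\<^bsub>A\<^esub>)) = f"
        by (simp add: \<pi>\<iota> f)
    qed
  next
    assume ?quasibase
    then obtain \<beta> \<tau>
      where dual: "\<forall>i<N. \<beta> i \<in> central_endos \<and> \<tau> i \<in> bimodule_hom A C E A_ring_C"
        and quasibase: "\<forall>f\<in>carrier E. (\<Oplus>\<^bsub>E\<^esub>i\<in>{..<N}. lsmult E (\<tau> i f) (\<beta> i)) = f"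
      by (elim exE conjE) (rule that)
    have \<beta>: "\<beta> i \<in> central_endos" and \<tau>: "\<tau> i \<in> bimodule_hom A C E A_ring_C" if "i < N" for i
      using dual that by simp_all
    have eq: "(\<Oplus>\<^bsub>E\<^esub>i\<in>{..<N}. lsmult E (\<tau> i f) (\<beta> i)) = f" if "f \<in> carrier E" for f
      using quasibase that by (rule bspec)
    show "\<exists>\<iota> \<pi>. (\<forall>i<N. \<iota> i \<in> bimodule_hom A C E A_ring_C \<and>
        \<pi> i \<in> bimodule_hom A C A_ring_C E) \<and>
        (\<forall>f\<in>carrier E. (\<Oplus>\<^bsub>E\<^esub>i\<in>{..<N}. \<pi> i (\<iota> i f)) = f)"
    proof (intro exI conjI allI impI ballI)
      fix i assume i: "i < N"
      show "\<tau> i \<in> bimodule_hom A C E A_ring_C" by (rule \<tau>[OF i])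
      show "(\<lambda>a. lsmult E a (\<beta> i)) \<in> bimodule_hom A C A_ring_C E"
        using \<beta>[OF i] by (intro E.lsmult_central_hom hom_C_A) (simp_all add: central_endos_def)
    qed (rule eq)
  qed
qed


section \<open>Exchanging central tensors and bimodule maps\<close>

lemma eval_hom: "x \<in> carrier A \<Longrightarrow> abelian_group_hom E A (\<lambda>f. f x)"
  by (intro abelian_group_hom_of_additive abelian_group_E A.abelian_group_axioms)
    (simp_all add: E_D E_simps)

lemma tens_hom_left: "y \<in> carrier A \<Longrightarrow> abelian_group_hom A AA (\<lambda>x. tens x y)"
  by (intro abelian_group_hom_of_additive A.abelian_group_axioms AA.abelian_group_axioms)
    (simp_all add: tens_closed tens_add_left)

lemma tens_hom_right: "x \<in> carrier A \<Longrightarrow> abelian_group_hom A AA (tens x)"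
  by (intro abelian_group_hom_of_additive A.abelian_group_axioms AA.abelian_group_axioms)
    (simp_all add: tens_closed tens_add_right)

text \<open>Evaluating \<open>ev f\<close> at \<open>x \<otimes> 1 = \<Sum> t\<^sub>i \<beta>\<^sub>i(x)\<close> gives \<open>f(x) = \<Sum> ev f (t\<^sub>i) \<beta>\<^sub>i(x)\<close>.\<close>

lemma left_depth_three_imp_End_direct_summand:
  assumes "left_depth_three A B C g h"
  shows "\<exists>N>0. iso_to_direct_summand A C E (power_bimodule N A_ring_C)"
proof -
  from assms obtain N :: nat and \<beta> t where N: "N > 0"
    and central: "\<forall>i<N. \<beta> i \<in> central_endos \<and> t i \<in> central_tensors"
    and quasibase: "\<forall>x\<in>carrier A.
      (\<Oplus>\<^bsub>AA\<^esub>i\<in>{..<N}. rsmult AA (t i) (\<beta> i x)) = tens x \<one>\<^bsub>A\<^esub>"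
    unfolding left_depth_three_iff by (elim exE conjE) (rule that)
  have \<beta>: "\<beta> i \<in> carrier E" and t: "t i \<in> carrier AA"
    and t_central: "\<And>c. c \<in> carrier C \<Longrightarrow> lsmult AA c (t i) = rsmult AA (t i) (g (h c))"
    if "i < N" for i
    using central that by (simp_all add: central_endos_def central_tensors_def)
  interpret AC: bimodule A C A_ring_C by (rule bimodule_A_C)
  have hom: "(\<lambda>f. ev f (t i)) \<in> bimodule_hom A C E A_ring_C" if i: "i < N" for i
    using t[OF i]
    by (intro bimodule_homI abelian_group_E AC.abelian_group_axioms)
      (simp_all add: ring_bimodule_simps ev_closed ev_add_endo ev_lsmult_endo ev_rsmult_endo
        t_central[OF i] ev_rsmult gh_closed)
  have dual: "(\<Oplus>\<^bsub>E\<^esub>i\<in>{..<N}. lsmult E (ev f (t i)) (\<beta> i)) = f" (is "?s = f")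
    if f: "f \<in> carrier E" for f
  proof (rule E_eqI)
    have c: "(\<lambda>i. lsmult E (ev f (t i)) (\<beta> i)) \<in> {..<N} \<rightarrow> carrier E"
      using f t \<beta> by (simp add: Pi_def E_closed ev_closed)
    then show "?s \<in> carrier E" by (rule E.finsum_closed)
    fix x assume x: "x \<in> carrier A"
    have "?s x = (\<Oplus>\<^bsub>A\<^esub>i\<in>{..<N}. lsmult E (ev f (t i)) (\<beta> i) x)"
      by (rule abelian_group_hom.hom_finsum[OF eval_hom[OF x] c])
    also have "\<dots> = (\<Oplus>\<^bsub>A\<^esub>i\<in>{..<N}. ev f (rsmult AA (t i) (\<beta> i x)))"
      using x f t E_D(1)[OF \<beta>]
      by (intro A.finsum_cong') (simp_all add: Pi_def E_simps ev_rsmult ev_closed)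
    also have "\<dots> = ev f (\<Oplus>\<^bsub>AA\<^esub>i\<in>{..<N}. rsmult AA (t i) (\<beta> i x))"
      using x t E_D(1)[OF \<beta>]
      by (intro abelian_group_hom.hom_finsum[OF ev_hom[OF f], symmetric])
        (simp add: Pi_def AA.rsmult_closed)
    also have "\<dots> = ev f (tens x \<one>\<^bsub>A\<^esub>)"
      using quasibase x by simp
    also have "\<dots> = f x"
      using x f by (simp add: ev_tens E_D(1)[OF f])
    finally show "?s x = f x" .
  qed (rule f)
  have "iso_to_direct_summand A C E (power_bimodule N A_ring_C)"
    unfolding End_direct_summand_iff
    using central hom dual
    by (intro exI[of _ \<beta>] exI[of _ "\<lambda>i f. ev f (t i)"]) simp
  then show ?thesis using N by blast
qed

text \<open>
  The hypotheses on \<open>I\<close> and \<open>\<phi>\<close> describe a dual basis of \<open>A\<^sub>B\<close>. That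
  \<open>t\<^sub>i = \<Sum> k \<otimes> \<tau>\<^sub>i(\<gamma>\<^sub>k)\<close> commutes with \<open>C\<close> and that \<open>x \<otimes> 1 = \<Sum> t\<^sub>i \<beta>\<^sub>i(x)\<close> both rest on moving
  coefficients \<open>\<gamma>\<^sub>k(x)\<close>, which come from \<open>B\<close>, across the tensor sign, exchanging the sums, and
  collecting the left factor by \<open>\<Sum> k \<gamma>\<^sub>k(x) = x\<close>.
\<close>

lemma End_direct_summand_imp_left_depth_three:
  assumes I: "finite I" "I \<subseteq> carrier A"
    and \<phi>_closed: "\<And>k x. \<lbrakk>k \<in> I; x \<in> carrier A\<rbrakk> \<Longrightarrow> \<phi> k x \<in> carrier B"
    and \<phi>_add: "\<And>k x y. \<lbrakk>k \<in> I; x \<in> carrier A; y \<in> carrier A\<rbrakk> \<Longrightarrow>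
      \<phi> k (x \<oplus>\<^bsub>A\<^esub> y) = \<phi> k x \<oplus>\<^bsub>B\<^esub> \<phi> k y"
    and \<phi>_mult: "\<And>k x b. \<lbrakk>k \<in> I; x \<in> carrier A; b \<in> carrier B\<rbrakk> \<Longrightarrow>
      \<phi> k (x \<otimes>\<^bsub>A\<^esub> g b) = \<phi> k x \<otimes>\<^bsub>B\<^esub> b"
    and basis: "\<And>x. x \<in> carrier A \<Longrightarrow> (\<Oplus>\<^bsub>A\<^esub>k\<in>I. k \<otimes>\<^bsub>A\<^esub> g (\<phi> k x)) = x"
    and N: "N > 0" and summand: "iso_to_direct_summand A C E (power_bimodule N A_ring_C)"
  shows "left_depth_three A B C g h"
proof -
  from summand obtain \<beta> \<tau>
    where \<beta>\<tau>: "\<forall>i<N. \<beta> i \<in> central_endos \<and> \<tau> i \<in> bimodule_hom A C E A_ring_C"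
      and quasibase: "\<forall>f\<in>carrier E. (\<Oplus>\<^bsub>E\<^esub>i\<in>{..<N}. lsmult E (\<tau> i f) (\<beta> i)) = f"
    unfolding End_direct_summand_iff by (elim exE conjE) (rule that)
  have \<beta>: "\<beta> i \<in> carrier E" and \<tau>: "\<tau> i \<in> bimodule_hom A C E A_ring_C" if "i < N" for i
    using \<beta>\<tau> that by (simp_all add: central_endos_def)
  note \<tau>D = bimodule_homD(2-5)[OF \<tau>, unfolded ring_bimodule_simps]
  have I_carrier: "k \<in> carrier A" if "k \<in> I" for k using I(2) that by (rule subsetD)
  define \<gamma> where "\<gamma> k = (\<lambda>x\<in>carrier A. g (\<phi> k x))" for k
  have \<gamma>: "\<gamma> k \<in> carrier E" if "k \<in> I" for k
    unfolding E_iff \<gamma>_def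
    using that by (simp add: \<phi>_closed \<phi>_add \<phi>_mult g_closed ring_hom_add[OF hom_B_A]
        ring_hom_mult[OF hom_B_A])
  have \<gamma>_closed: "\<gamma> k x \<in> carrier A" if "k \<in> I" "x \<in> carrier A" for k x
    using \<gamma> that by (simp add: E_D(1))
  have \<gamma>_tens: "tens k (\<gamma> k x \<otimes>\<^bsub>A\<^esub> y) = tens (k \<otimes>\<^bsub>A\<^esub> \<gamma> k x) y"
    if "k \<in> I" "x \<in> carrier A" "y \<in> carrier A" for k x y
    using that by (simp add: \<gamma>_def tens_balanced \<phi>_closed I_carrier)
  have \<gamma>_basis: "(\<Oplus>\<^bsub>A\<^esub>k\<in>I. k \<otimes>\<^bsub>A\<^esub> \<gamma> k x) = x" if x: "x \<in> carrier A" for x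
  proof -
    have "(\<Oplus>\<^bsub>A\<^esub>k\<in>I. k \<otimes>\<^bsub>A\<^esub> \<gamma> k x) = (\<Oplus>\<^bsub>A\<^esub>k\<in>I. k \<otimes>\<^bsub>A\<^esub> g (\<phi> k x))"
      using x by (intro A.finsum_cong') (simp_all add: \<gamma>_def Pi_def I_carrier g_closed \<phi>_closed)
    then show ?thesis using basis[OF x] by simp
  qed
  have \<gamma>_dual: "(\<Oplus>\<^bsub>E\<^esub>k\<in>I. lsmult E (f k) (\<gamma> k)) = f" (is "?s = f") if f: "f \<in> carrier E" for f
  proof (rule E_eqI)
    have c: "(\<lambda>k. lsmult E (f k) (\<gamma> k)) \<in> I \<rightarrow> carrier E"
      using \<gamma> I_carrier by (simp add: Pi_def E_closed E_D(1)[OF f])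
    then show "?s \<in> carrier E" by (rule E.finsum_closed)
    fix x assume x: "x \<in> carrier A"
    have "?s x = (\<Oplus>\<^bsub>A\<^esub>k\<in>I. lsmult E (f k) (\<gamma> k) x)"
      by (rule abelian_group_hom.hom_finsum[OF eval_hom[OF x] c])
    also have "\<dots> = (\<Oplus>\<^bsub>A\<^esub>k\<in>I. f (k \<otimes>\<^bsub>A\<^esub> g (\<phi> k x)))"
      using x by (intro A.finsum_cong')
        (simp_all add: \<gamma>_def Pi_def E_simps E_D[OF f] I_carrier \<phi>_closed g_closed)
    also have "\<dots> = f (\<Oplus>\<^bsub>A\<^esub>k\<in>I. k \<otimes>\<^bsub>A\<^esub> g (\<phi> k x))"
    proof (rule abelian_group_hom.hom_finsum[symmetric])
      show "abelian_group_hom A A f"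
        by (intro abelian_group_hom_of_additive A.abelian_group_axioms E_D[OF f])
    qed (use x in \<open>simp add: Pi_def I_carrier g_closed \<phi>_closed\<close>)
    finally show "?s x = f x" using basis[OF x] by simp
  qed (rule f)
  define t where "t i = (\<Oplus>\<^bsub>AA\<^esub>k\<in>I. tens k (\<tau> i (\<gamma> k)))" for i
  have t_summand: "(\<lambda>k. tens k (\<tau> i (\<gamma> k))) \<in> I \<rightarrow> carrier AA" if "i < N" for i
    using that by (simp add: Pi_def tens_closed I_carrier \<tau>D(1) \<gamma>)
  have t_rsmult: "rsmult AA (t i) a = (\<Oplus>\<^bsub>AA\<^esub>k\<in>I. tens k (\<tau> i (\<gamma> k) \<otimes>\<^bsub>A\<^esub> a))"
    if i: "i < N" and a: "a \<in> carrier A" for i a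
  proof -
    have "rsmult AA (t i) a = (\<Oplus>\<^bsub>AA\<^esub>k\<in>I. rsmult AA (tens k (\<tau> i (\<gamma> k))) a)"
      unfolding t_def by (rule abelian_group_hom.hom_finsum[OF AA.rsmult_hom[OF a] t_summand[OF i]])
    also have "\<dots> = (\<Oplus>\<^bsub>AA\<^esub>k\<in>I. tens k (\<tau> i (\<gamma> k) \<otimes>\<^bsub>A\<^esub> a))"
      using i a by (intro AA.finsum_cong')
        (simp_all add: Pi_def tens_rsmult tens_closed I_carrier \<tau>D(1) \<gamma>)
    finally show ?thesis .
  qed
  have collect: "(\<Oplus>\<^bsub>AA\<^esub>k\<in>I. tens (k \<otimes>\<^bsub>A\<^esub> \<gamma> k x) y) = tens x y"
    if x: "x \<in> carrier A" and y: "y \<in> carrier A" for x y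
    using abelian_group_hom.hom_finsum[OF tens_hom_left[OF y], of "\<lambda>k. k \<otimes>\<^bsub>A\<^esub> \<gamma> k x" I]
      \<gamma>_basis[OF x] x
    by (simp add: Pi_def I_carrier \<gamma>_closed)
  have "t i \<in> central_tensors" if i: "i < N" for i
    unfolding central_tensors_def
  proof (intro CollectI conjI ballI)
    show "t i \<in> carrier AA"
      unfolding t_def using t_summand[OF i] by (rule AA.finsum_closed)
    fix c assume c: "c \<in> carrier C"
    note gh = gh_closed[OF c]
    \<comment> \<open>\<open>\<gamma>\<^sub>k c\<close> has coordinates \<open>\<gamma>\<^sub>k(c l)\<close> in the dual basis, since \<open>(\<gamma>\<^sub>k c)(l) = \<gamma>\<^sub>k(c l)\<close>.\<close>
    have "\<tau> i (\<gamma> k) \<otimes>\<^bsub>A\<^esub> g (h c) = (\<Oplus>\<^bsub>A\<^esub>l\<in>I. \<gamma> k (g (h c) \<otimes>\<^bsub>A\<^esub> l) \<otimes>\<^bsub>A\<^esub> \<tau> i (\<gamma> l))"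
      if k: "k \<in> I" for k
    proof -
      have "\<tau> i (\<gamma> k) \<otimes>\<^bsub>A\<^esub> g (h c) = \<tau> i (rsmult E (\<gamma> k) c)"
        using \<tau>D(4)[OF i \<gamma>[OF k] c] by simp
      also have "\<dots> = \<tau> i (\<Oplus>\<^bsub>E\<^esub>l\<in>I. lsmult E (rsmult E (\<gamma> k) c l) (\<gamma> l))"
        using \<gamma>_dual[OF E_closed(3)[OF \<gamma>[OF k] c]] by simp
      also have "\<dots> = (\<Oplus>\<^bsub>A\<^esub>l\<in>I. \<tau> i (lsmult E (rsmult E (\<gamma> k) c l) (\<gamma> l)))"
        using k \<gamma> gh I_carrier \<gamma>_closed
        by (subst abelian_group_hom.hom_finsum[OF bimodule_homD(1)[OF \<tau>[OF i]]])
          (simp_all add: Pi_def E_closed E_simps(3) finsum_ring_bimodule)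
      also have "\<dots> = (\<Oplus>\<^bsub>A\<^esub>l\<in>I. \<gamma> k (g (h c) \<otimes>\<^bsub>A\<^esub> l) \<otimes>\<^bsub>A\<^esub> \<tau> i (\<gamma> l))"
        using k gh I_carrier \<gamma>_closed \<gamma> i
        by (intro A.finsum_cong') (simp_all add: Pi_def E_simps(3) \<tau>D)
      finally show ?thesis .
    qed
    note move = this
    have "rsmult AA (t i) (g (h c)) =
        (\<Oplus>\<^bsub>AA\<^esub>k\<in>I. \<Oplus>\<^bsub>AA\<^esub>l\<in>I. tens (k \<otimes>\<^bsub>A\<^esub> \<gamma> k (g (h c) \<otimes>\<^bsub>A\<^esub> l)) (\<tau> i (\<gamma> l)))"
      unfolding t_rsmult[OF i gh]
    proof (intro AA.finsum_cong' refl)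
      show "(\<lambda>k. \<Oplus>\<^bsub>AA\<^esub>l\<in>I. tens (k \<otimes>\<^bsub>A\<^esub> \<gamma> k (g (h c) \<otimes>\<^bsub>A\<^esub> l)) (\<tau> i (\<gamma> l))) \<in> I \<rightarrow> carrier AA"
        using gh I_carrier \<gamma>_closed \<gamma> i
        by (intro funcsetI AA.finsum_closed) (simp add: tens_closed \<tau>D(1))
      fix k assume k: "k \<in> I"
      have "tens k (\<tau> i (\<gamma> k) \<otimes>\<^bsub>A\<^esub> g (h c)) =
          (\<Oplus>\<^bsub>AA\<^esub>l\<in>I. tens k (\<gamma> k (g (h c) \<otimes>\<^bsub>A\<^esub> l) \<otimes>\<^bsub>A\<^esub> \<tau> i (\<gamma> l)))"
        unfolding move[OF k] using k gh I_carrier \<gamma>_closed \<gamma> i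
        by (intro abelian_group_hom.hom_finsum[OF tens_hom_right]) (simp_all add: Pi_def \<tau>D(1))
      also have "\<dots> = (\<Oplus>\<^bsub>AA\<^esub>l\<in>I. tens (k \<otimes>\<^bsub>A\<^esub> \<gamma> k (g (h c) \<otimes>\<^bsub>A\<^esub> l)) (\<tau> i (\<gamma> l)))"
        using k gh I_carrier \<gamma>_closed \<gamma> i
        by (intro AA.finsum_cong') (simp_all add: Pi_def \<tau>D(1) \<gamma>_tens tens_closed)
      finally show "tens k (\<tau> i (\<gamma> k) \<otimes>\<^bsub>A\<^esub> g (h c)) =
          (\<Oplus>\<^bsub>AA\<^esub>l\<in>I. tens (k \<otimes>\<^bsub>A\<^esub> \<gamma> k (g (h c) \<otimes>\<^bsub>A\<^esub> l)) (\<tau> i (\<gamma> l)))" .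
    qed
    also have "\<dots> =
        (\<Oplus>\<^bsub>AA\<^esub>l\<in>I. \<Oplus>\<^bsub>AA\<^esub>k\<in>I. tens (k \<otimes>\<^bsub>A\<^esub> \<gamma> k (g (h c) \<otimes>\<^bsub>A\<^esub> l)) (\<tau> i (\<gamma> l)))"
      using I(1) gh I_carrier \<gamma>_closed \<gamma> i
      by (intro AA.finsum_swap) (simp_all add: tens_closed \<tau>D(1))
    also have "\<dots> = (\<Oplus>\<^bsub>AA\<^esub>l\<in>I. lsmult AA c (tens l (\<tau> i (\<gamma> l))))"
      using gh I_carrier \<gamma> i c
      by (intro AA.finsum_cong') (simp_all add: Pi_def collect tens_lsmult tens_closed \<tau>D(1))
    also have "\<dots> = lsmult AA c (t i)"
      unfolding t_def
      by (rule abelian_group_hom.hom_finsum[OF AA.lsmult_hom[OF c] t_summand[OF i], symmetric])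
    finally show "lsmult AA c (t i) = rsmult AA (t i) (g (h c))" by (rule sym)
  qed
  moreover have "(\<Oplus>\<^bsub>AA\<^esub>i\<in>{..<N}. rsmult AA (t i) (\<beta> i x)) = tens x \<one>\<^bsub>A\<^esub>"
    if x: "x \<in> carrier A" for x
  proof -
    have \<beta>x: "\<beta> i x \<in> carrier A" if "i < N" for i using E_D(1)[OF \<beta>[OF that] x] .
    have \<gamma>_quasibase: "(\<Oplus>\<^bsub>A\<^esub>i\<in>{..<N}. \<tau> i (\<gamma> k) \<otimes>\<^bsub>A\<^esub> \<beta> i x) = \<gamma> k x" if k: "k \<in> I" for k
    proof -
      have c: "(\<lambda>i. lsmult E (\<tau> i (\<gamma> k)) (\<beta> i)) \<in> {..<N} \<rightarrow> carrier E"
        by (simp add: Pi_def E_closed \<tau>D(1) \<gamma>[OF k] \<beta>)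
      have "\<gamma> k x = (\<Oplus>\<^bsub>E\<^esub>i\<in>{..<N}. lsmult E (\<tau> i (\<gamma> k)) (\<beta> i)) x"
        using quasibase \<gamma>[OF k] by simp
      also have "\<dots> = (\<Oplus>\<^bsub>A\<^esub>i\<in>{..<N}. lsmult E (\<tau> i (\<gamma> k)) (\<beta> i) x)"
        by (rule abelian_group_hom.hom_finsum[OF eval_hom[OF x] c])
      also have "\<dots> = (\<Oplus>\<^bsub>A\<^esub>i\<in>{..<N}. \<tau> i (\<gamma> k) \<otimes>\<^bsub>A\<^esub> \<beta> i x)"
        using x by (intro A.finsum_cong') (simp_all add: Pi_def E_simps(4) \<beta>x \<tau>D(1) \<gamma>[OF k])
      finally show ?thesis by (rule sym)
    qed
    have "(\<Oplus>\<^bsub>AA\<^esub>i\<in>{..<N}. rsmult AA (t i) (\<beta> i x)) =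
        (\<Oplus>\<^bsub>AA\<^esub>i\<in>{..<N}. \<Oplus>\<^bsub>AA\<^esub>k\<in>I. tens k (\<tau> i (\<gamma> k) \<otimes>\<^bsub>A\<^esub> \<beta> i x))"
    proof (intro AA.finsum_cong' refl)
      show "(\<lambda>i. \<Oplus>\<^bsub>AA\<^esub>k\<in>I. tens k (\<tau> i (\<gamma> k) \<otimes>\<^bsub>A\<^esub> \<beta> i x)) \<in> {..<N} \<rightarrow> carrier AA"
        by (intro funcsetI AA.finsum_closed) (simp add: tens_closed I_carrier \<tau>D(1) \<gamma> \<beta>x)
    qed (simp add: t_rsmult \<beta>x)
    also have "\<dots> = (\<Oplus>\<^bsub>AA\<^esub>k\<in>I. \<Oplus>\<^bsub>AA\<^esub>i\<in>{..<N}. tens k (\<tau> i (\<gamma> k) \<otimes>\<^bsub>A\<^esub> \<beta> i x))"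
      by (intro AA.finsum_swap) (simp_all add: tens_closed I_carrier \<tau>D(1) \<gamma> \<beta>x)
    also have "\<dots> = (\<Oplus>\<^bsub>AA\<^esub>k\<in>I. tens (k \<otimes>\<^bsub>A\<^esub> \<gamma> k x) \<one>\<^bsub>A\<^esub>)"
    proof (intro AA.finsum_cong' refl)
      show "(\<lambda>k. tens (k \<otimes>\<^bsub>A\<^esub> \<gamma> k x) \<one>\<^bsub>A\<^esub>) \<in> I \<rightarrow> carrier AA"
        using x by (simp add: Pi_def tens_closed I_carrier \<gamma>_closed)
      fix k assume k: "k \<in> I"
      have "(\<Oplus>\<^bsub>AA\<^esub>i\<in>{..<N}. tens k (\<tau> i (\<gamma> k) \<otimes>\<^bsub>A\<^esub> \<beta> i x)) =
          tens k (\<Oplus>\<^bsub>A\<^esub>i\<in>{..<N}. \<tau> i (\<gamma> k) \<otimes>\<^bsub>A\<^esub> \<beta> i x)"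
        using k by (intro abelian_group_hom.hom_finsum[OF tens_hom_right, symmetric])
          (simp_all add: Pi_def I_carrier \<tau>D(1) \<gamma> \<beta>x)
      also have "\<dots> = tens k (\<gamma> k x \<otimes>\<^bsub>A\<^esub> \<one>\<^bsub>A\<^esub>)"
        using k x by (simp add: \<gamma>_quasibase \<gamma>_closed)
      also have "\<dots> = tens (k \<otimes>\<^bsub>A\<^esub> \<gamma> k x) \<one>\<^bsub>A\<^esub>"
        using k x by (intro \<gamma>_tens) simp_all
      finally show "(\<Oplus>\<^bsub>AA\<^esub>i\<in>{..<N}. tens k (\<tau> i (\<gamma> k) \<otimes>\<^bsub>A\<^esub> \<beta> i x)) =
          tens (k \<otimes>\<^bsub>A\<^esub> \<gamma> k x) \<one>\<^bsub>A\<^esub>" .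
    qed
    also have "\<dots> = tens x \<one>\<^bsub>A\<^esub>"
      using x by (simp add: collect)
    finally show ?thesis .
  qed
  ultimately show ?thesis
    unfolding left_depth_three_iff using N \<beta>\<tau>
    by (intro exI[of _ N] exI[of _ \<beta>] exI[of _ t] conjI) simp_all
qed

end

theorem theorem2p8:
  fixes A :: "('a, 'k) ring_scheme" and B :: "('b, 'l) ring_scheme"
    and C :: "('c, 'm) ring_scheme" and g :: "'b \<Rightarrow> 'a" and h :: "'c \<Rightarrow> 'b"
  assumes "ring_tower A B C g h"
    and "finitely_generated_right_module B (ring_bimodule id g A)"
    and "projective_right_module B (ring_bimodule id g A)"
  shows "left_depth_three A B C g h \<longleftrightarrow>
    (\<exists>N>0. iso_to_direct_summand A C (End_bimodule A B g h)
      (power_bimodule N (ring_bimodule id (g \<circ> h) A)))"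
proof
  interpret ring_tower A B C g h by fact
  show "\<exists>N>0. iso_to_direct_summand A C E (power_bimodule N A_ring_C)"
    if "left_depth_three A B C g h"
    using that by (rule left_depth_three_imp_End_direct_summand)
  assume "\<exists>N>0. iso_to_direct_summand A C E (power_bimodule N A_ring_C)"
  then obtain N where N: "N > 0" "iso_to_direct_summand A C E (power_bimodule N A_ring_C)"
    by blast
  obtain I \<phi> where "finite I" "I \<subseteq> carrier A"
    and "\<And>k x. \<lbrakk>k \<in> I; x \<in> carrier A\<rbrakk> \<Longrightarrow> \<phi> k x \<in> carrier B"
    and "\<And>k x y. \<lbrakk>k \<in> I; x \<in> carrier A; y \<in> carrier A\<rbrakk> \<Longrightarrow>
      \<phi> k (x \<oplus>\<^bsub>A\<^esub> y) = \<phi> k x \<oplus>\<^bsub>B\<^esub> \<phi> k y"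
    and "\<And>k x b. \<lbrakk>k \<in> I; x \<in> carrier A; b \<in> carrier B\<rbrakk> \<Longrightarrow>
      \<phi> k (x \<otimes>\<^bsub>A\<^esub> g b) = \<phi> k x \<otimes>\<^bsub>B\<^esub> b"
    and "\<And>x. x \<in> carrier A \<Longrightarrow> (\<Oplus>\<^bsub>A\<^esub>k\<in>I. k \<otimes>\<^bsub>A\<^esub> g (\<phi> k x)) = x"
    by (rule dual_basis[OF assms(2,3), unfolded ring_bimodule_simps finsum_ring_bimodule])
      (rule that)
  then show "left_depth_three A B C g h"
    using N by (rule End_direct_summand_imp_left_depth_three)
qed

end
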